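(* Let $\gamma_0:\mathbb{S}^1\to\mathbb{R}^2$ be a regular smooth immersed closed curve with length $L_0$, signed enclosed area $A_0=A[\gamma_0]>0$, $\int k\,ds=2\pi$, $K_{\mathrm{osc}}[\gamma_0]<K^*$ and $I[\gamma_0]<\frac{4\pi^2}{4\pi^2-K^*}$. Let $\gamma:\mathbb{S}^1\times[0,\infty)\to\mathbb{R}^2$ be the solution of the length-constrained curve diffusion flow with $\gamma(\cdot,0)=\gamma_0$. Then $$\mathcal{L}\left\{t\in[0,\infty): k(\cdot,t)\not>0\right\}\le\frac{L_0^2}{4\pi^3}\left(\frac{L_0^2}{4\pi}-A_0\right),$$ where $\mathcal{L}$ denotes Lebesgue measure and $k(\cdot,t)\not>0$ means that there exists $x\in\mathbb{S}^1$ with $k(x,t)\le0$.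
   Context: For a closed regular plane curve, $s$ is arc length, $\nu$ is the unit normal obtained by rotating the unit tangent $\gamma_s$ by $+\pi/2$, $k$ is the scalar curvature ($\gamma_{ss}=k\nu$), and subscripts $s$ denote arc length derivatives. $L[\gamma]$ is the length, $A[\gamma]=-\frac12\int\langle\gamma,\nu\rangle\,ds$ the signed enclosed area, $\omega=\frac1{2\pi}\int k\,ds$ the winding number. The average curvature is $\overline{k}=\frac{1}{L}\int k\,ds$, the normalised oscillation of curvature is $K_{\mathrm{osc}}[\gamma]=L\int(k-\overline{k})^2\,ds$, and the isoperimetric ratio is $I[\gamma]=\frac{L^2}{4\pi A}$. Length-constrained curve diffusion flow: a one-parameter family of closed immersed curves with normal velocity $$\partial_t^\perp\gamma:=\langle\partial_t\gamma,\nu\rangle=h(t)-k_{ss},\qquad h(t)=-\frac{\int k_s^2\,ds}{2\pi\omega},$$ integrals being over $\gamma_t=\gamma(\cdot,t)$. Only the normal velocity is prescribed; tangential components correspond to reparametrisation. Length is constant along the flow, equal to $L_0$. The constant $K^*>0$: $2K^*$ is the smallest positive solution $x$ of $2-\frac{1}{4\pi^2\sqrt{2\pi}}x^{3/2}-\frac{3}{2\pi}x-6x^{1/2}=0$. *)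

theory Defs
  imports "HOL-Analysis.Analysis"
begin

text \<open>The plane is identified with the complex numbers, so that rotation by \<open>+\<pi>/2\<close> is
  multiplication by \<open>\<i>\<close>. The circle is \<open>\<real>/2\<pi>\<int>\<close>: maps on it are \<open>2\<pi>\<close>-periodic maps on the reals.\<close>

definition smooth_curve :: "(real \<Rightarrow> complex) \<Rightarrow> bool" where
  "smooth_curve \<gamma> \<longleftrightarrow>
     (\<exists>D :: nat \<Rightarrow> real \<Rightarrow> complex. D 0 = \<gamma> \<and>
       (\<forall>n u. (D n has_vector_derivative D (Suc n) u) (at u)))"

definition regular_closed_curve :: "(real \<Rightarrow> complex) \<Rightarrow> bool" where
  "regular_closed_curve \<gamma> \<longleftrightarrow>
     smooth_curve \<gamma> \<and> (\<forall>u. \<gamma> (u + 2 * pi) = \<gamma> u) \<and> (\<forall>u. vector_derivative \<gamma> (at u) \<noteq> 0)"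

definition speed :: "(real \<Rightarrow> complex) \<Rightarrow> real \<Rightarrow> real" where
  "speed \<gamma> u = norm (vector_derivative \<gamma> (at u))"

definition arc_deriv ::
    "(real \<Rightarrow> complex) \<Rightarrow> (real \<Rightarrow> 'a::real_normed_vector) \<Rightarrow> real \<Rightarrow> 'a" where
  "arc_deriv \<gamma> f u = vector_derivative f (at u) /\<^sub>R speed \<gamma> u"

definition arc_integral :: "(real \<Rightarrow> complex) \<Rightarrow> (real \<Rightarrow> real) \<Rightarrow> real" where
  "arc_integral \<gamma> f = integral {0..2 * pi} (\<lambda>u. f u * speed \<gamma> u)"

definition unit_normal :: "(real \<Rightarrow> complex) \<Rightarrow> real \<Rightarrow> complex" where
  "unit_normal \<gamma> u = \<i> * arc_deriv \<gamma> \<gamma> u"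

text \<open>The scalar \<open>k\<close> with \<open>\<gamma>\<^sub>s\<^sub>s = k \<nu>\<close>; as \<open>\<gamma>\<^sub>s\<^sub>s\<close> is a multiple of the unit vector \<open>\<nu>\<close>, it is
  read off by pairing with \<open>\<nu>\<close>.\<close>

definition curvature :: "(real \<Rightarrow> complex) \<Rightarrow> real \<Rightarrow> real" where
  "curvature \<gamma> u = arc_deriv \<gamma> (arc_deriv \<gamma> \<gamma>) u \<bullet> unit_normal \<gamma> u"

definition curve_length :: "(real \<Rightarrow> complex) \<Rightarrow> real" where
  "curve_length \<gamma> = arc_integral \<gamma> (\<lambda>u. 1)"

definition signed_area :: "(real \<Rightarrow> complex) \<Rightarrow> real" where
  "signed_area \<gamma> = - (1 / 2) * arc_integral \<gamma> (\<lambda>u. \<gamma> u \<bullet> unit_normal \<gamma> u)"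

text \<open>The winding number of the tangent, not of the curve about a point.\<close>

definition curve_winding :: "(real \<Rightarrow> complex) \<Rightarrow> real" where
  "curve_winding \<gamma> = 1 / (2 * pi) * arc_integral \<gamma> (curvature \<gamma>)"

definition mean_curvature :: "(real \<Rightarrow> complex) \<Rightarrow> real" where
  "mean_curvature \<gamma> = 1 / curve_length \<gamma> * arc_integral \<gamma> (curvature \<gamma>)"

definition K_osc :: "(real \<Rightarrow> complex) \<Rightarrow> real" where
  "K_osc \<gamma> = curve_length \<gamma> * arc_integral \<gamma> (\<lambda>u. (curvature \<gamma> u - mean_curvature \<gamma>)\<^sup>2)"

definition isoperimetric_ratio :: "(real \<Rightarrow> complex) \<Rightarrow> real" where
  "isoperimetric_ratio \<gamma> = (curve_length \<gamma>)\<^sup>2 / (4 * pi * signed_area \<gamma>)"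

definition K_star :: real where
  "K_star = (LEAST x::real. 0 < x \<and>
     2 - 1 / (4 * pi\<^sup>2 * sqrt (2 * pi)) * x powr (3/2) - 3 / (2 * pi) * x - 6 * x powr (1/2) = 0) / 2"

text \<open>Families \<open>\<gamma> t u\<close> that are jointly smooth for \<open>t \<ge> 0\<close>, up to and including \<open>t = 0\<close> (where
  time derivatives are one-sided). \<open>D m n\<close> is the partial derivative of order \<open>m\<close> in \<open>t\<close> and \<open>n\<close>
  in \<open>u\<close>. Values of \<open>\<gamma>\<close> at negative times are irrelevant.\<close>

definition smooth_family :: "(real \<Rightarrow> real \<Rightarrow> complex) \<Rightarrow> bool" where
  "smooth_family \<gamma> \<longleftrightarrow>
     (\<exists>D :: nat \<Rightarrow> nat \<Rightarrow> real \<Rightarrow> real \<Rightarrow> complex. D 0 0 = \<gamma> \<and>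
       (\<forall>m n. continuous_on ({0..} \<times> UNIV) (\<lambda>(t, u). D m n t u) \<and>
         (\<forall>t\<ge>0. \<forall>u.
           ((\<lambda>\<tau>. D m n \<tau> u) has_vector_derivative D (Suc m) n t u) (at t within {0..}) \<and>
           (D m n t has_vector_derivative D m (Suc n) t u) (at u))))"

definition flow_h :: "(real \<Rightarrow> complex) \<Rightarrow> real" where
  "flow_h \<gamma> = - arc_integral \<gamma> (\<lambda>u. (arc_deriv \<gamma> (curvature \<gamma>) u)\<^sup>2) / (2 * pi * curve_winding \<gamma>)"

text \<open>Only the normal velocity is prescribed; the tangential velocity is arbitrary.\<close>

definition length_constrained_cdf :: "(real \<Rightarrow> real \<Rightarrow> complex) \<Rightarrow> bool" where
  "length_constrained_cdf \<gamma> \<longleftrightarrow>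
     smooth_family \<gamma> \<and>
     (\<forall>t\<ge>0. regular_closed_curve (\<gamma> t)) \<and>
     (\<forall>t\<ge>0. \<forall>u.
        vector_derivative (\<lambda>\<tau>. \<gamma> \<tau> u) (at t within {0..}) \<bullet> unit_normal (\<gamma> t) u
          = flow_h (\<gamma> t) - arc_deriv (\<gamma> t) (arc_deriv (\<gamma> t) (curvature (\<gamma> t))) u)"

end

theory Submission
  imports Defs
begin

text \<open>Along the flow the length \<open>L\<close> and the total curvature \<open>2\<pi>\<close> are constant, while
  \<open>A' = L / (2\<pi>) \<integral> k\<^sub>s\<^sup>2 ds \<ge> 0\<close>; as \<open>A \<le> L\<^sup>2 / (4\<pi>)\<close>, it suffices that
  \<open>\<integral> k\<^sub>s\<^sup>2 ds \<ge> 8\<pi>\<^sup>4 / L\<^sup>3\<close> whenever \<open>k \<le> 0\<close> somewhere. No evolution equation for \<open>k\<close> enters: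
  since \<open>A\<close> increases, the hypothesis on the isoperimetric ratio persists, and \<open>K\<^sup>* \<le> 1/18\<close> makes
  every \<open>\<gamma>\<^sub>t\<close> almost a circle.

  Normalise \<open>L = 2\<pi>\<close>, let \<open>T\<close> be the unit tangent as a function of arc length and write
  \<open>e\<^sup>-\<^sup>i\<^sup>s T = c e\<^sup>i\<^sup>\<phi>\<close>, so that \<open>\<phi>' = f := k - 1\<close>. Wirtinger's inequality turns the isoperimetric
  deficit into an \<open>L\<^sup>2\<close> bound on the deviation of \<open>e\<^sup>-\<^sup>i\<^sup>s T\<close> from a constant. If \<open>\<parallel>f'\<parallel>\<^sup>2 < \<pi>\<close>, then
  \<open>\<phi>\<close> oscillates by at most \<open>\<pi> / \<surd>2\<close>, chords are comparable with arcs, and \<open>\<parallel>\<phi> - m\<parallel>\<close> is small for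
  the mean \<open>m\<close> of \<open>\<phi>\<close>. But \<open>f \<le> -1\<close> somewhere, so
  \<open>1 \<le> \<parallel>f\<parallel>\<^sub>\<infinity>\<^sup>4 \<le> \<parallel>f\<parallel>\<^sup>2 \<parallel>f'\<parallel>\<^sup>2 \<le> \<parallel>\<phi> - m\<parallel> \<parallel>f'\<parallel>\<^sup>3\<close>, a contradiction.\<close>

section \<open>Integral inequalities on an interval and on the circle\<close>

text \<open>Discriminant argument: the quadratic form in \<open>quad\<close> is the integral of a
  square. If \<open>Q = 0\<close> it is affine in \<open>d\<close>, which forces
  \<open>R = 0\<close>; otherwise it is evaluated at its minimising direction
  \<open>(Q, - R)\<close>.\<close>

lemma integral_Cauchy_Schwarz:
  fixes f g :: "real \<Rightarrow> real"
  assumes f: "continuous_on {a..b} f" and g: "continuous_on {a..b} g"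
  shows "(integral {a..b} (\<lambda>x. f x * g x))\<^sup>2
    \<le> integral {a..b} (\<lambda>x. (f x)\<^sup>2) * integral {a..b} (\<lambda>x. (g x)\<^sup>2)"
proof -
  define P where "P = integral {a..b} (\<lambda>x. (f x)\<^sup>2)"
  define Q where "Q = integral {a..b} (\<lambda>x. (g x)\<^sup>2)"
  define R where "R = integral {a..b} (\<lambda>x. f x * g x)"
  have quad: "0 \<le> c\<^sup>2 * P + 2 * c * d * R + d\<^sup>2 * Q" for c d
  proof -
    have "((\<lambda>x. c\<^sup>2 * (f x)\<^sup>2 + 2 * c * d * (f x * g x) + d\<^sup>2 * (g x)\<^sup>2) has_integral
        c\<^sup>2 * P + 2 * c * d * R + d\<^sup>2 * Q) {a..b}"
      unfolding P_def Q_def R_def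
      by (intro has_integral_add has_integral_mult_right integrable_integral
          integrable_continuous_real continuous_intros f g)
    moreover have "c\<^sup>2 * (f x)\<^sup>2 + 2 * c * d * (f x * g x) + d\<^sup>2 * (g x)\<^sup>2 = (c * f x + d * g x)\<^sup>2" for x
      by (simp add: power2_eq_square algebra_simps)
    ultimately show ?thesis
      by (auto intro: has_integral_nonneg)
  qed
  have P: "0 \<le> P" and Q: "0 \<le> Q"
    unfolding P_def Q_def by (auto intro!: integral_nonneg integrable_continuous_real continuous_intros f g)
  have "R\<^sup>2 \<le> P * Q"
  proof (cases "Q = 0")
    case True
    have "R = 0"
    proof (rule ccontr)
      assume "R \<noteq> 0"
      with quad[of 1 "- (P + 1) / R"] True P show False by simp
    qed
    then show ?thesis using P Q by simp
  next
    case False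
    have "0 \<le> Q * (P * Q - R\<^sup>2)"
      using quad[of Q "- R"] by (simp add: power2_eq_square algebra_simps)
    with False Q show ?thesis by (simp add: zero_le_mult_iff)
  qed
  then show ?thesis unfolding P_def Q_def R_def .
qed

lemma integral_deriv_closed:
  fixes F :: "real \<Rightarrow> 'a::banach"
  assumes "a \<le> b" "\<And>x. x \<in> {a..b} \<Longrightarrow> (F has_vector_derivative F' x) (at x within {a..b})" "F a = F b"
  shows "(F' has_integral 0) {a..b}"
  using fundamental_theorem_of_calculus[OF assms(1,2)] assms(3) by simp

text \<open>Gluing \<open>a\<close> to \<open>b\<close> gives a loop that \<open>x\<close> and
  \<open>y\<close> cut into two arcs, and \<open>G\<close> has to cover the same difference along
  each of them. This is the source of the factor 2, on which the constants below depend.\<close>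

lemma closed_oscillation_bound:
  fixes G :: "real \<Rightarrow> real"
  assumes G: "\<And>x. x \<in> {a..b} \<Longrightarrow> (G has_real_derivative G' x) (at x within {a..b})"
    and G': "continuous_on {a..b} G'" and "G a = G b" and "x \<in> {a..b}" "y \<in> {a..b}"
  shows "2 * \<bar>G x - G y\<bar> \<le> integral {a..b} (\<lambda>x. \<bar>G' x\<bar>)"
proof -
  have inc: "\<bar>G d - G c\<bar> \<le> integral {c..d} (\<lambda>x. \<bar>G' x\<bar>)" if "a \<le> c" "c \<le> d" "d \<le> b" for c d
  proof -
    have sub: "{c..d} \<subseteq> {a..b}" using that by auto
    have "(G' has_integral (G d - G c)) {c..d}"
    proof (rule fundamental_theorem_of_calculus[OF \<open>c \<le> d\<close>])
      fix x assume "x \<in> {c..d}"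
      with sub have "(G has_real_derivative G' x) (at x within {c..d})"
        by (intro DERIV_subset[OF G sub]) auto
      then show "(G has_vector_derivative G' x) (at x within {c..d})"
        by (simp add: has_real_derivative_iff_has_vector_derivative)
    qed
    then have "integral {c..d} G' = G d - G c" by auto
    moreover have "norm (integral {c..d} G') \<le> integral {c..d} (\<lambda>x. \<bar>G' x\<bar>)"
      using continuous_on_subset[OF G' sub]
      by (intro integral_norm_bound_integral integrable_continuous_real continuous_intros) auto
    ultimately show ?thesis by simp
  qed
  have main: "2 * \<bar>G x - G y\<bar> \<le> integral {a..b} (\<lambda>x. \<bar>G' x\<bar>)" if "a \<le> x" "x \<le> y" "y \<le> b" for x y
  proof -
    have i: "(\<lambda>x. \<bar>G' x\<bar>) integrable_on {a..b}"
      by (intro integrable_continuous_real continuous_intros G')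
    have "integral {a..x} (\<lambda>x. \<bar>G' x\<bar>) + integral {x..b} (\<lambda>x. \<bar>G' x\<bar>) = integral {a..b} (\<lambda>x. \<bar>G' x\<bar>)"
      using that by (intro Henstock_Kurzweil_Integration.integral_combine i) auto
    moreover have "integral {x..y} (\<lambda>x. \<bar>G' x\<bar>) + integral {y..b} (\<lambda>x. \<bar>G' x\<bar>) = integral {x..b} (\<lambda>x. \<bar>G' x\<bar>)"
      using that by (intro Henstock_Kurzweil_Integration.integral_combine integrable_subinterval_real[OF i]) auto
    ultimately show ?thesis
      using inc[OF order_refl \<open>a \<le> x\<close>] inc[OF that] inc[OF _ \<open>y \<le> b\<close> order_refl] \<open>G a = G b\<close>
        that abs_minus_commute[of "G x" "G y"] abs_triangle_ineq[of "G x - G b" "G b - G y"]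
      by simp
  qed
  show ?thesis using main[of x y] main[of y x] assms(4,5) by (cases "x \<le> y") (auto simp: abs_minus_commute)
qed

lemma power2_norm_diff:
  fixes v w :: "'a::real_inner"
  shows "(norm (v - w))\<^sup>2 = (norm v)\<^sup>2 + (norm w)\<^sup>2 - 2 * (v \<bullet> w)"
  by (simp add: power2_norm_eq_inner inner_diff_left inner_diff_right inner_commute algebra_simps)

text \<open>The variance identity in its two-point form. It lets a pointwise comparison of distances
  between values turn into a comparison of deviations from the mean.\<close>

lemma integral_double_dist:
  fixes h :: "real \<Rightarrow> 'a::euclidean_space"
  assumes h: "continuous_on {a..b} h" and "a \<le> b"
  shows "((\<lambda>x. integral {a..b} (\<lambda>y. (norm (h x - h y))\<^sup>2)) has_integral
    (2 * (b - a) * integral {a..b} (\<lambda>x. (norm (h x))\<^sup>2) - 2 * (norm (integral {a..b} h))\<^sup>2)) {a..b}"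
proof -
  let ?N = "integral {a..b} (\<lambda>x. (norm (h x))\<^sup>2)" and ?I = "integral {a..b} h"
  have N: "((\<lambda>x. (norm (h x))\<^sup>2) has_integral ?N) {a..b}"
    by (intro integrable_integral integrable_continuous_real continuous_intros h)
  have I: "(h has_integral ?I) {a..b}"
    by (intro integrable_integral integrable_continuous_real continuous_intros h)
  have in1: "((\<lambda>y. v \<bullet> h y) has_integral (v \<bullet> ?I)) {a..b}" for v
    using has_integral_linear[OF I bounded_linear_inner_right[of v]] by (simp add: o_def)
  have c: "((\<lambda>y. c) has_integral ((b - a) * c)) {a..b}" for c :: real
    using has_integral_const_real[of c a b] \<open>a \<le> b\<close> by simp
  have inner: "integral {a..b} (\<lambda>y. (norm (h x - h y))\<^sup>2)
      = (b - a) * (norm (h x))\<^sup>2 + ?N - 2 * (?I \<bullet> h x)" for x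
    unfolding power2_norm_diff
    by (rule integral_unique, subst inner_commute[of ?I])
      (intro has_integral_diff has_integral_add has_integral_mult_right c N in1)
  have "((\<lambda>x. (b - a) * (norm (h x))\<^sup>2 + ?N - 2 * (?I \<bullet> h x)) has_integral
      (b - a) * ?N + (b - a) * ?N - 2 * (?I \<bullet> ?I)) {a..b}"
    by (intro has_integral_diff has_integral_add has_integral_mult_right c N in1)
  then show ?thesis
    unfolding inner by (simp add: power2_norm_eq_inner algebra_simps)
qed

text \<open>The first Dirichlet eigenvalue of an interval of length pi is 1. Fourier series are
  avoided: the minimiser \<open>sin (x - a)\<close> enters through its logarithmic derivative, the
  cotangent.\<close>

lemma integral_square_le_deriv_Dirichlet:
  fixes g :: "real \<Rightarrow> real"
  assumes g: "\<And>x. (g has_real_derivative g' x) (at x)"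
    and g': "continuous_on UNIV g'" and "g a = 0" "g (a + pi) = 0"
  shows "integral {a..a + pi} (\<lambda>x. (g x)\<^sup>2) \<le> integral {a..a + pi} (\<lambda>x. (g' x)\<^sup>2)"
proof -
  define G where "G = (\<lambda>x. (g x)\<^sup>2 * (cos (x - a) / sin (x - a)))"
  have cg: "continuous_on UNIV g"
    using g by (meson DERIV_isCont continuous_at_imp_continuous_on)
  have sin_pos: "sin (x - a) > 0" if "a < x" "x < a + pi" for x
    using that by (intro sin_gt_zero) auto
  have dG: "(G has_real_derivative
      2 * g x * g' x * (cos (x - a) / sin (x - a)) - (g x)\<^sup>2 * (1 + (cos (x - a) / sin (x - a))\<^sup>2)) (at x)"
    if "a < x" "x < a + pi" for x
  proof -
    note s = sin_pos[OF that]
    have "((\<lambda>x. cos (x - a) / sin (x - a)) has_real_derivative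
       (- sin (x - a) * sin (x - a) - cos (x - a) * cos (x - a)) / (sin (x - a) * sin (x - a))) (at x)"
      using s by (auto intro!: derivative_eq_intros)
    from DERIV_mult'[OF DERIV_power[OF g[of x], of 2] this]
    have D: "(G has_real_derivative (g x)\<^sup>2 * ((- sin (x - a) * sin (x - a) - cos (x - a) * cos (x - a)) / (sin (x - a) * sin (x - a)))
       + 2 * g x * g' x * (cos (x - a) / sin (x - a))) (at x)"
      unfolding G_def by (rule DERIV_cong) simp
    have eq: "(- sin (x - a) * sin (x - a) - cos (x - a) * cos (x - a)) / (sin (x - a) * sin (x - a))
       = - (1 + (cos (x - a) / sin (x - a))\<^sup>2)"
      using s by (simp add: diff_divide_distrib power2_eq_square)
    show ?thesis using D[unfolded eq] by (rule DERIV_cong) (simp add: algebra_simps)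
  qed
  \<comment> \<open>At an endpoint \<open>g\<close> and the sine both vanish to first order, so
    their quotient stays bounded and the second factor \<open>g\<close> forces the limit 0. Hence
    \<open>G\<close> is continuous up to the endpoints, where it has the value 0.\<close>
  have lim: "(G \<longlongrightarrow> 0) (at p)" if p: "g p = 0" "sin (p - a) = 0" "cos (p - a) \<noteq> 0" for p
  proof -
    have 1: "((\<lambda>x. g x / (x - p)) \<longlongrightarrow> g' p) (at p)"
      using g[of p] p(1) by (simp add: has_field_derivative_iff)
    have "((\<lambda>x. sin (x - a)) has_real_derivative cos (p - a)) (at p)"
      by (auto intro!: derivative_eq_intros)
    then have 2: "((\<lambda>x. sin (x - a) / (x - p)) \<longlongrightarrow> cos (p - a)) (at p)"
      using p(2) by (simp add: has_field_derivative_iff)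
    have 3: "(g \<longlongrightarrow> 0) (at p)"
      using DERIV_isCont[OF g[of p]] p(1) by (simp add: isCont_def)
    have 4: "((\<lambda>x. cos (x - a)) \<longlongrightarrow> cos (p - a)) (at p)"
      by (intro tendsto_intros)
    have "((\<lambda>x. g x * cos (x - a) * ((g x / (x - p)) / (sin (x - a) / (x - p)))) \<longlongrightarrow>
       0 * cos (p - a) * (g' p / cos (p - a))) (at p)"
      by (intro tendsto_mult tendsto_divide 1 2 3 4 p)
    then have "((\<lambda>x. g x * cos (x - a) * ((g x / (x - p)) / (sin (x - a) / (x - p)))) \<longlongrightarrow> 0) (at p)"
      by simp
    then show ?thesis
      by (rule Lim_transform_within[OF _ zero_less_one])
        (auto simp: G_def power2_eq_square)
  qed
  have G0: "G a = 0" "G (a + pi) = 0" by (auto simp: G_def)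
  have cG: "continuous_on {a..a + pi} G"
  proof (rule continuous_at_imp_continuous_on, rule ballI)
    fix x assume x: "x \<in> {a..a + pi}"
    consider "x = a" | "x = a + pi" | "a < x" "x < a + pi" using x by fastforce
    then show "isCont G x"
    proof cases
      case 1 then show ?thesis using lim[of a] assms(3) G0 by (simp add: isCont_def)
    next
      case 2 then show ?thesis using lim[of "a + pi"] assms(4) G0 by (simp add: isCont_def)
    next
      case 3 then show ?thesis using dG DERIV_isCont by blast
    qed
  qed
  define E where "E = (\<lambda>x. 2 * g x * g' x * (cos (x - a) / sin (x - a))
      - (g x)\<^sup>2 * (1 + (cos (x - a) / sin (x - a))\<^sup>2))"
  have E: "(E has_integral 0) {a..a + pi}"
    using fundamental_theorem_of_calculus_interior[of a "a + pi" G E] cG dG G0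
    by (auto simp: E_def has_real_derivative_iff_has_vector_derivative)
  have int: "((\<lambda>x. (g' x)\<^sup>2 - (g x)\<^sup>2) has_integral
      (integral {a..a + pi} (\<lambda>x. (g' x)\<^sup>2) - integral {a..a + pi} (\<lambda>x. (g x)\<^sup>2))) {a..a + pi}"
    by (intro has_integral_diff integrable_integral integrable_continuous_real continuous_intros
      continuous_on_subset[OF cg] continuous_on_subset[OF g']) auto
  \<comment> \<open>\<open>g'\<^sup>2 - g\<^sup>2 - (g\<^sup>2 cot)' = (g' - g cot)\<^sup>2\<close>; at the two endpoints \<open>cot\<close> is \<open>0\<close> by \<open>x/0 = 0\<close>.\<close>
  have "E x \<le> (g' x)\<^sup>2 - (g x)\<^sup>2" for x
  proof -
    have "0 \<le> (g' x - g x * (cos (x - a) / sin (x - a)))\<^sup>2" by simp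
    then show ?thesis unfolding E_def by (simp add: power2_eq_square algebra_simps)
  qed
  then have "0 \<le> integral {a..a + pi} (\<lambda>x. (g' x)\<^sup>2) - integral {a..a + pi} (\<lambda>x. (g x)\<^sup>2)"
    by (intro has_integral_le[OF E int]) auto
  then show ?thesis by simp
qed

lemma integral_periodic_shift:
  fixes f :: "real \<Rightarrow> 'a::euclidean_space"
  assumes f: "continuous_on UNIV f" and per: "\<And>x. f (x + p) = f x" and "0 \<le> a" "a \<le> p"
  shows "integral {a..a + p} f = integral {0..p} f"
proof -
  have i: "f integrable_on {c..d}" for c d
    by (intro integrable_continuous_real continuous_on_subset[OF f]) auto
  have "integral {a..p} f + integral {p..a + p} f = integral {a..a + p} f"
    using assms(3,4) by (intro Henstock_Kurzweil_Integration.integral_combine i) auto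
  moreover have "integral {0..a} f + integral {a..p} f = integral {0..p} f"
    using assms(3,4) by (intro Henstock_Kurzweil_Integration.integral_combine i) auto
  moreover have "integral {p..a + p} f = integral {0..a} f"
    using integral_shift_Icc_real[of 0 a f p] by (simp add: o_def add.commute[of p] per)
  ultimately show ?thesis by (metis add.commute)
qed

lemma Wirtinger_inequality:
  fixes g :: "real \<Rightarrow> real"
  assumes g: "\<And>x. (g has_real_derivative g' x) (at x)" and g': "continuous_on UNIV g'"
    and per: "\<And>x. g (x + 2 * pi) = g x" and mean: "integral {0..2 * pi} g = 0"
  shows "integral {0..2 * pi} (\<lambda>x. (g x)\<^sup>2) \<le> integral {0..2 * pi} (\<lambda>x. (g' x)\<^sup>2)"
proof -
  have cg: "continuous_on UNIV g"
    using g by (meson DERIV_isCont continuous_at_imp_continuous_on)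
  have per': "g' (x + 2 * pi) = g' x" for x
  proof -
    have "((\<lambda>x. g (x + 2 * pi)) has_real_derivative g' (x + 2 * pi)) (at x)"
      using DERIV_shift g by blast
    then show ?thesis using g[of x] per DERIV_unique by (metis (no_types, lifting) ext)
  qed
  \<comment> \<open>two points at distance \<open>\<pi>\<close> with the same value split the circle into two Dirichlet intervals\<close>
  obtain a where a: "0 \<le> a" "a \<le> pi" "g (a + pi) = g a"
  proof -
    define d where "d = (\<lambda>x. g (x + pi) - g x)"
    have cd: "continuous_on {0..pi} d"
      unfolding d_def
      by (intro continuous_intros continuous_on_compose2[OF cg]) auto
    have "d pi = - d 0" using per[of 0] by (simp add: d_def)
    then have "\<exists>x\<ge>0. x \<le> pi \<and> d x = 0"
      using IVT'[of d 0 0 pi] IVT2'[of d pi 0 0] cd pi_ge_zero by (cases "d 0 \<le> 0") auto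
    then show ?thesis using that by (auto simp: d_def)
  qed
  define c where "c = g a"
  let ?g = "\<lambda>x. g x - c"
  have dg: "(?g has_real_derivative g' x) (at x)" for x
    using g by (auto intro!: derivative_eq_intros)
  have per2: "g (a + pi + pi) = c"
    using per[of a] by (simp add: c_def add.assoc)
  have split: "integral {a..a + pi} h + integral {a + pi..a + pi + pi} h = integral {0..2*pi} h"
    if h: "continuous_on UNIV h" and hp: "\<And>x. h (x + 2 * pi) = h x" for h :: "real \<Rightarrow> real"
  proof -
    have "integral {a..a + pi} h + integral {a + pi..a + pi + pi} h = integral {a..a + pi + pi} h"
      by (intro Henstock_Kurzweil_Integration.integral_combine integrable_continuous_real continuous_on_subset[OF h]) auto
    also have "\<dots> = integral {0..2*pi} h"
      using integral_periodic_shift[OF h hp, of a] a pi_ge_zero by (simp add: add.assoc)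
    finally show ?thesis .
  qed
  have "integral {0..2*pi} (\<lambda>x. (?g x)\<^sup>2) \<le> integral {0..2*pi} (\<lambda>x. (g' x)\<^sup>2)"
  proof -
    have "integral {a..a + pi} (\<lambda>x. (?g x)\<^sup>2) \<le> integral {a..a + pi} (\<lambda>x. (g' x)\<^sup>2)"
      by (rule integral_square_le_deriv_Dirichlet[OF dg g']) (auto simp: c_def a)
    moreover have "integral {a + pi..a + pi + pi} (\<lambda>x. (?g x)\<^sup>2) \<le> integral {a + pi..a + pi + pi} (\<lambda>x. (g' x)\<^sup>2)"
      by (rule integral_square_le_deriv_Dirichlet[OF dg g']) (use a(3) per2 in \<open>simp_all add: c_def\<close>)
    moreover note split[of "\<lambda>x. (?g x)\<^sup>2"] split[of "\<lambda>x. (g' x)\<^sup>2"]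
    ultimately show ?thesis
      by (simp add: per per' continuous_on_power continuous_on_diff cg g')
  qed
  \<comment> \<open>Here the vanishing mean enters: the cross term drops out, so replacing
    \<open>g\<close> by \<open>g - c\<close> can only increase the left-hand side.\<close>
  moreover have "integral {0..2*pi} (\<lambda>x. (?g x)\<^sup>2) = integral {0..2*pi} (\<lambda>x. (g x)\<^sup>2) + 2 * pi * c\<^sup>2"
  proof -
    have m: "(g has_integral 0) {0..2*pi}"
      using integrable_integral[of g "{0..2*pi}"] mean continuous_on_subset[OF cg]
      by (metis integrable_continuous_real subset_UNIV)
    have k: "((\<lambda>x. c\<^sup>2) has_integral 2 * pi * c\<^sup>2) {0..2*pi}"
      using has_integral_const_real[of "c\<^sup>2" 0 "2*pi"] by simp
    have "((\<lambda>x. (g x)\<^sup>2 - 2 * c * g x + c\<^sup>2) has_integral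
       (integral {0..2*pi} (\<lambda>x. (g x)\<^sup>2) - 2 * c * 0 + 2 * pi * c\<^sup>2)) {0..2*pi}"
      by (intro has_integral_diff has_integral_add has_integral_mult_right k m integrable_integral
        integrable_continuous_real continuous_intros continuous_on_subset[OF cg]) auto
    then show ?thesis
      by (intro integral_unique) (simp add: power2_eq_square algebra_simps)
  qed
  moreover have "0 \<le> 2 * pi * c\<^sup>2" by simp
  ultimately show ?thesis by linarith
qed

lemma has_vector_derivative_cis:
  assumes "(h has_real_derivative h') (at x within S)"
  shows "((\<lambda>x. cis (h x)) has_vector_derivative of_real h' * (\<i> * cis (h x))) (at x within S)"
proof -
  have "((\<lambda>x. \<i> * of_real (h x)) has_vector_derivative \<i> * of_real h') (at x within S)"
    using assms unfolding has_real_derivative_iff_has_vector_derivative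
    by (intro has_vector_derivative_mult_right
        bounded_linear.has_vector_derivative[OF bounded_linear_of_real])
  from field_vector_diff_chain_within[OF this DERIV_exp[THEN DERIV_subset]]
  show ?thesis by (simp add: cis_conv_exp o_def ac_simps)
qed

text \<open>The Maclaurin remainder of order four has a coefficient of at most 1/24.\<close>

lemma cos_le_quartic: "cos x \<le> 1 - x\<^sup>2 / 2 + x ^ 4 / (24::real)"
proof -
  obtain t where "cos x = (\<Sum>m<4. cos_coeff m * x ^ m) + (cos (t + 1/2 * real 4 * pi) / fact 4) * x ^ 4"
    using Maclaurin_cos_expansion[of x 4] by blast
  moreover have "(\<Sum>m<4. cos_coeff m * x ^ m) = 1 - x\<^sup>2 / 2"
  proof -
    have "{..<4::nat} = {0, 1, 2, 3}" by auto
    then show ?thesis by (simp add: cos_coeff_def)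
  qed
  moreover have "(cos (t + 1/2 * real 4 * pi) / fact 4) * x ^ 4 \<le> (1 / fact 4) * x ^ 4"
    by (intro mult_right_mono divide_right_mono) auto
  ultimately show ?thesis by (simp add: fact_numeral)
qed

text \<open>The quartic bound at 8/5 is about -0.007, so 8/5 lies beyond the zero of the cosine at
  \<open>pi / 2\<close>.\<close>

lemma pi_less_16_5: "pi < 16 / 5"
proof (rule ccontr)
  assume "\<not> pi < 16 / 5"
  then have "0 \<le> cos (8/5::real)"
    by (intro cos_ge_zero) auto
  moreover have "cos (8/5::real) < 0"
    using cos_le_quartic[of "8/5"] by (simp add: power2_eq_square eval_nat_numeral)
  ultimately show False by simp
qed

lemma Wirtinger_inequality_complex:
  fixes g :: "real \<Rightarrow> complex"
  assumes g: "\<And>x. (g has_vector_derivative g' x) (at x)" and g': "continuous_on UNIV g'"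
    and per: "\<And>x. g (x + 2 * pi) = g x" and mean: "integral {0..2 * pi} g = 0"
  shows "integral {0..2 * pi} (\<lambda>x. (norm (g x))\<^sup>2) \<le> integral {0..2 * pi} (\<lambda>x. (norm (g' x))\<^sup>2)"
proof -
  have cg: "continuous_on UNIV g"
    using g has_vector_derivative_continuous continuous_at_imp_continuous_on by blast
  have cs: "continuous_on {0..2 * pi} g" "continuous_on {0..2 * pi} g'"
    using cg g' continuous_on_subset by blast+
  have ig: "g integrable_on {0..2 * pi}" by (intro integrable_continuous_real cs)
  have main: "integral {0..2 * pi} (\<lambda>x. (c (g x))\<^sup>2) \<le> integral {0..2 * pi} (\<lambda>x. (c (g' x))\<^sup>2)"
    if c: "bounded_linear c" for c :: "complex \<Rightarrow> real"
  proof (rule Wirtinger_inequality)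
    show "((\<lambda>x. c (g x)) has_real_derivative c (g' x)) (at x)" for x
      unfolding has_real_derivative_iff_has_vector_derivative
      by (rule bounded_linear.has_vector_derivative[OF c g])
    show "continuous_on UNIV (\<lambda>x. c (g' x))"
      by (rule bounded_linear.continuous_on[OF c g'])
    show "integral {0..2 * pi} (\<lambda>x. c (g x)) = 0"
      using integral_linear[OF ig c] mean c by (simp add: o_def linear_simps)
  qed (simp add: per)
  have split: "integral {0..2 * pi} (\<lambda>x. (norm (h x))\<^sup>2) =
    integral {0..2 * pi} (\<lambda>x. (Re (h x))\<^sup>2) + integral {0..2 * pi} (\<lambda>x. (Im (h x))\<^sup>2)"
    if "continuous_on {0..2 * pi} h" for h :: "real \<Rightarrow> complex"
    unfolding cmod_power2
    by (intro integral_add integrable_continuous_real continuous_intros that)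
  show ?thesis
    unfolding split[OF cs(1)] split[OF cs(2)]
    using main[OF bounded_linear_Re] main[OF bounded_linear_Im] by linarith
qed

text \<open>By Rolle's theorem for an antiderivative, \<open>f\<close> has a zero \<open>y\<close>.
  The oscillation bound for the square of \<open>f\<close> between \<open>y\<close> and
  \<open>x\<close> then has a factor 2 on both sides, which cancels, and Cauchy-Schwarz
  finishes.\<close>

lemma closed_sup_bound:
  fixes f :: "real \<Rightarrow> real"
  assumes f: "\<And>x. x \<in> {a..b} \<Longrightarrow> (f has_real_derivative f' x) (at x within {a..b})"
    and f': "continuous_on {a..b} f'" and "f a = f b" and mean: "integral {a..b} f = 0"
    and "a < b" and x: "x \<in> {a..b}"
  shows "f x ^ 4 \<le> integral {a..b} (\<lambda>x. (f x)\<^sup>2) * integral {a..b} (\<lambda>x. (f' x)\<^sup>2)"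
proof -
  have cf: "continuous_on {a..b} f"
    using f DERIV_continuous_on by blast
  obtain y where y: "y \<in> {a..b}" "f y = 0"
  proof -
    define F where "F = (\<lambda>x. integral {a..x} f)"
    have F: "(F has_real_derivative f x) (at x within {a..b})" if "x \<in> {a..b}" for x
      unfolding F_def by (rule integral_has_real_derivative[OF cf that])
    have "(F has_derivative (\<lambda>v. f z * v)) (at z)" if "a < z" "z < b" for z
      using F[of z] that at_within_Icc_at[of a z b] by (simp add: has_field_derivative_def)
    moreover have "F a = F b" using mean by (simp add: F_def)
    moreover have "continuous_on {a..b} F" using F DERIV_continuous_on by blast
    ultimately have "\<exists>z. a < z \<and> z < b \<and> (\<lambda>v. f z * v) = (\<lambda>v. 0)"
      using Rolle_deriv[of a b F "\<lambda>z v. f z * v"] \<open>a < b\<close> by blast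
    then obtain z where "a < z" "z < b" "(\<lambda>v. f z * v) = (\<lambda>v. 0)" by blast
    from this(3) have "f z = 0" by (metis mult.right_neutral)
    then show ?thesis using that[of z] \<open>a < z\<close> \<open>z < b\<close> by simp
  qed
  have "2 * \<bar>(f x)\<^sup>2 - (f y)\<^sup>2\<bar> \<le> integral {a..b} (\<lambda>x. \<bar>2 * f x * f' x\<bar>)"
  proof (rule closed_oscillation_bound[where G = "\<lambda>x. (f x)\<^sup>2"])
    show "((\<lambda>x. (f x)\<^sup>2) has_real_derivative 2 * f x * f' x) (at x within {a..b})" if "x \<in> {a..b}" for x
      using f[OF that] by (auto intro!: derivative_eq_intros)
  qed (use assms y cf in \<open>auto intro!: continuous_intros\<close>)
  also have "\<dots> = 2 * integral {a..b} (\<lambda>x. \<bar>f x\<bar> * \<bar>f' x\<bar>)"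
    by (simp add: abs_mult mult.assoc)
  finally have "(f x)\<^sup>2 \<le> integral {a..b} (\<lambda>x. \<bar>f x\<bar> * \<bar>f' x\<bar>)"
    using y by simp
  then have "((f x)\<^sup>2)\<^sup>2 \<le> (integral {a..b} (\<lambda>x. \<bar>f x\<bar> * \<bar>f' x\<bar>))\<^sup>2"
    by (intro power_mono) auto
  also have "\<dots> \<le> integral {a..b} (\<lambda>x. \<bar>f x\<bar>\<^sup>2) * integral {a..b} (\<lambda>x. \<bar>f' x\<bar>\<^sup>2)"
    by (intro integral_Cauchy_Schwarz continuous_intros cf f')
  finally show ?thesis by (simp flip: power_mult)
qed

text \<open>The isoperimetric inequality with stability, in Hurwitz's style but in a rotating frame.
  Here \<open>?A\<close> is twice the enclosed area; \<open>w\<close> is constant for a unit circle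
  traversed once anticlockwise. With \<open>c\<close> the mean of \<open>v\<close>, the witness is
  \<open>a = \<i> * c\<close>, and completing squares gives
  \<open>?W = 2 * (2 * pi - ?A) - ?P + ?Q\<close>. Wirtinger for \<open>u = v - c\<close> yields
  \<open>?Q \<le> ?P\<close>; both conclusions follow, the first because \<open>?W\<close> is
  nonnegative.\<close>

lemma unit_speed_isoperimetric:
  fixes z T :: "real \<Rightarrow> complex"
  assumes z: "\<And>s. (z has_vector_derivative T s) (at s)" and T: "continuous_on UNIV T"
    and unit: "\<And>s. norm (T s) = 1" and per: "\<And>s. z (s + 2 * pi) = z s"
  obtains a where
    "integral {0..2 * pi} (\<lambda>s. Im (cnj (z s) * T s)) \<le> 2 * pi"
    "integral {0..2 * pi} (\<lambda>s. (norm (cis (- s) * T s - a))\<^sup>2)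
      \<le> 2 * (2 * pi - integral {0..2 * pi} (\<lambda>s. Im (cnj (z s) * T s)))"
proof -
  define v where "v = (\<lambda>s. cis (- s) * z s)"
  define w where "w = (\<lambda>s. cis (- s) * T s)"
  define v' where "v' = (\<lambda>s. w s - \<i> * v s)"
  define c where "c = integral {0..2 * pi} v / of_real (2 * pi)"
  define u where "u = (\<lambda>s. v s - c)"
  have cz: "continuous_on UNIV z"
    using z has_vector_derivative_continuous continuous_at_imp_continuous_on by blast
  have cis: "((\<lambda>s. cis (- s)) has_vector_derivative - \<i> * cis (- s)) (at s)" for s
  proof -
    have "((\<lambda>s. - s) has_real_derivative - 1) (at s)" by (auto intro!: derivative_eq_intros)
    from has_vector_derivative_cis[OF this] show ?thesis by simp
  qed
  have ccis: "continuous_on UNIV (\<lambda>s. cis (- s))"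
    using cis has_vector_derivative_continuous continuous_at_imp_continuous_on by blast
  have dv: "(v has_vector_derivative v' s) (at s)" for s
    unfolding v_def v'_def w_def
    by (rule has_vector_derivative_eq_rhs[OF has_vector_derivative_mult[OF cis z]]) simp
  have du: "(u has_vector_derivative v' s) (at s)" for s
    unfolding u_def by (rule has_vector_derivative_eq_rhs[OF has_vector_derivative_diff[OF dv has_vector_derivative_const]]) simp
  have cont: "continuous_on S v" "continuous_on S w" "continuous_on S v'" "continuous_on S u" for S
    unfolding u_def v'_def v_def w_def
    by (intro continuous_intros continuous_on_subset[OF cz] continuous_on_subset[OF T] continuous_on_subset[OF ccis] subset_UNIV)+
  have perv: "v (s + 2 * pi) = v s" for s
    using per[of s] cis_mult[of "- s" "- (2 * pi)"] cis_cnj[of "2 * pi"] by (simp add: v_def)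
  let ?A = "integral {0..2 * pi} (\<lambda>s. Im (cnj (z s) * T s))"
  let ?P = "integral {0..2 * pi} (\<lambda>s. (norm (v' s))\<^sup>2)"
  let ?Q = "integral {0..2 * pi} (\<lambda>s. (norm (u s))\<^sup>2)"
  have PQ: "?Q \<le> ?P"
  proof (rule Wirtinger_inequality_complex[OF du cont(3)])
    show "u (x + 2 * pi) = u x" for x by (simp add: u_def perv)
    have "(u has_integral (integral {0..2 * pi} v - of_real (2 * pi) * c)) {0..2 * pi}"
      unfolding u_def using has_integral_const_real[of c 0 "2 * pi"]
      by (intro has_integral_diff integrable_integral integrable_continuous_real cont)
        (simp add: scaleR_conv_of_real)
    then show "integral {0..2 * pi} u = 0" by (auto simp: c_def)
  qed
  have v'0: "(v' has_integral 0) {0..2 * pi}"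
    using perv[of 0] by (intro integral_deriv_closed[of _ _ v] dv[THEN has_vector_derivative_at_within]) auto
  have ic: "((\<lambda>s. (\<i> * c) \<bullet> v' s) has_integral 0) {0..2 * pi}"
    using has_integral_linear[OF v'0 bounded_linear_inner_right[of "\<i> * c"]] by (simp add: o_def)
  have area: "Im (cnj (z s) * T s) = (\<i> * v s) \<bullet> w s" for s
  proof -
    have "cnj (v s) * w s = (cnj (cis (- s)) * cis (- s)) * (cnj (z s) * T s)"
      by (simp only: v_def w_def complex_cnj_mult mult_ac)
    also have "cnj (cis (- s)) * cis (- s) = 1"
      by (simp only: cis_cnj cis_mult) simp
    finally have "Im (cnj (z s) * T s) = Im (cnj (v s) * w s)" by simp
    then show ?thesis by (simp add: inner_complex_def algebra_simps)
  qed
  have unitw: "norm (w s) = 1" for s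
    by (simp add: w_def norm_mult unit)
  \<comment> \<open>Used with \<open>p = w s\<close>, \<open>q = \<i> * v s\<close>,
    \<open>r = \<i> * c\<close>. Then \<open>p - q\<close> is \<open>v' s\<close>,
    \<open>q - r\<close> has the norm of \<open>u s\<close>, and the term with \<open>r\<close>
    integrates to 0 because \<open>v\<close> is closed.\<close>
  have expand: "(norm (p - r))\<^sup>2 = 2 * (1 - q \<bullet> p) - 2 * (r \<bullet> (p - q)) - (norm (p - q))\<^sup>2 + (norm (q - r))\<^sup>2"
    if "norm p = 1" for p q r :: complex
    using that unfolding power2_norm_diff inner_diff_right
      inner_commute[of p q] inner_commute[of p r] inner_commute[of q r]
    by simp
  have ident: "(norm (w s - \<i> * c))\<^sup>2 = 2 * (1 - Im (cnj (z s) * T s)) - 2 * ((\<i> * c) \<bullet> v' s)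
      - (norm (v' s))\<^sup>2 + (norm (u s))\<^sup>2" for s
  proof -
    have "norm (\<i> * v s - \<i> * c) = norm (u s)"
      by (simp add: u_def norm_mult flip: right_diff_distrib)
    then show ?thesis
      unfolding area v'_def using expand[OF unitw, of s "\<i> * c" "\<i> * v s"] by simp
  qed
  let ?W = "integral {0..2 * pi} (\<lambda>s. (norm (w s - \<i> * c))\<^sup>2)"
  have "((\<lambda>s. (norm (w s - \<i> * c))\<^sup>2) has_integral (2 * (2 * pi - ?A) - 2 * 0 - ?P + ?Q)) {0..2 * pi}"
    unfolding ident using has_integral_const_real[of "1::real" 0 "2 * pi"]
    by (intro has_integral_add has_integral_diff has_integral_mult_right ic integrable_integral
        integrable_continuous_real continuous_intros cont continuous_on_subset[OF cz] continuous_on_subset[OF T])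
      auto
  then have W: "?W = 2 * (2 * pi - ?A) - ?P + ?Q" by (simp add: integral_unique)
  moreover have "0 \<le> ?W"
    by (intro integral_nonneg integrable_continuous_real continuous_intros cont) auto
  moreover have "A \<le> 2 * pi \<and> W \<le> 2 * (2 * pi - A)"
    if "W = 2 * (2 * pi - A) - P + Q" "0 \<le> W" "Q \<le> P" for A W P Q :: real
    using that by argo
  ultimately have "?A \<le> 2 * pi \<and> ?W \<le> 2 * (2 * pi - ?A)"
    using PQ by blast
  then show ?thesis using that unfolding w_def by blast
qed

section \<open>Unit speed curves of length \<open>2\<pi>\<close>\<close>

text \<open>The second assumption is Frenet's equation with curvature \<open>\<kappa>\<close>. Unit
  speed and period \<open>2 * pi\<close> fix the length to be \<open>2 * pi\<close>, and the unit
  circle has \<open>\<kappa> = 1\<close>.\<close>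

locale unit_speed_curve =
  fixes z T :: "real \<Rightarrow> complex" and \<kappa> \<kappa>' :: "real \<Rightarrow> real"
  assumes z: "\<And>s. (z has_vector_derivative T s) (at s)"
    and T: "\<And>s. (T has_vector_derivative of_real (\<kappa> s) * (\<i> * T s)) (at s)"
    and \<kappa>: "\<And>s. (\<kappa> has_real_derivative \<kappa>' s) (at s)" and \<kappa>': "continuous_on UNIV \<kappa>'"
    and unit: "\<And>s. norm (T s) = 1"
    and per: "\<And>s. z (s + 2 * pi) = z s" "\<And>s. \<kappa> (s + 2 * pi) = \<kappa> s"
begin

lemma continuous_on_T: "continuous_on S T"
  by (rule continuous_on_vector_derivative[OF T[THEN has_vector_derivative_at_within]])

text \<open>The area hypothesis bounds exactly the right-hand side of
  \<open>unit_speed_isoperimetric\<close>, hence the deviation of \<open>w\<close> from a constant.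
  The threshold \<open>pi\<close> is the normalised form of
  \<open>8 * pi ^ 4 / L ^ 3\<close>.\<close>

lemma curvature_energy_ge_pi:
  assumes total: "integral {0..2 * pi} \<kappa> = 2 * pi"
    and area: "2 * (2 * pi - integral {0..2 * pi} (\<lambda>s. Im (cnj (z s) * T s))) \<le> 1 / (18 * pi)"
    and s0: "s0 \<in> {0..2 * pi}" "\<kappa> s0 \<le> 0"
  shows "pi \<le> integral {0..2 * pi} (\<lambda>s. (\<kappa>' s)\<^sup>2)"
proof (rule ccontr)
  let ?J = "{0..2 * pi}"
  define f where "f = (\<lambda>s. \<kappa> s - 1)"
  define w where "w = (\<lambda>s. cis (- s) * T s)"
  define X where "X = integral ?J (\<lambda>s. (f s)\<^sup>2)"
  define Y where "Y = integral ?J (\<lambda>s. (\<kappa>' s)\<^sup>2)"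
  assume "\<not> pi \<le> integral ?J (\<lambda>s. (\<kappa>' s)\<^sup>2)"
  then have Y: "Y < pi" by (simp add: Y_def)
  have c\<kappa>: "continuous_on UNIV \<kappa>"
    using \<kappa> by (meson DERIV_isCont continuous_at_imp_continuous_on)
  have cf: "continuous_on S f" and c\<kappa>'S: "continuous_on S \<kappa>'" for S
    unfolding f_def by (intro continuous_intros continuous_on_subset[OF c\<kappa>] continuous_on_subset[OF \<kappa>'] subset_UNIV)+
  have df: "(f has_real_derivative \<kappa>' s) (at s)" for s
    unfolding f_def using \<kappa>[of s] by (auto intro!: derivative_eq_intros)
  have f0: "integral ?J f = 0"
    unfolding f_def using total has_integral_const_real[of "1::real" 0 "2 * pi"]
    by (subst integral_diff) (auto intro!: integrable_continuous_real continuous_on_subset[OF c\<kappa>])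
  have f_ends: "f 0 = f (2 * pi)" using per(2)[of 0] by (simp add: f_def)
  have XY: "X \<le> Y"
    unfolding X_def Y_def
    by (rule Wirtinger_inequality[OF df \<kappa>' _ f0]) (simp add: f_def per)
  have pos: "0 \<le> X" "0 \<le> Y"
    unfolding X_def Y_def by (auto intro!: integral_nonneg integrable_continuous_real continuous_intros cf c\<kappa>'S)
  have one_le: "1 \<le> X * Y"
  proof -
    have "1 \<le> - f s0" using s0 by (simp add: f_def)
    then have "1 ^ 4 \<le> (- f s0) ^ 4" by (intro power_mono) auto
    also have "\<dots> \<le> X * Y"
      unfolding X_def Y_def
      using closed_sup_bound[OF df[THEN DERIV_subset[OF _ subset_UNIV]] c\<kappa>'S f_ends f0 _ s0(1)] by simp
    finally show ?thesis by simp
  qed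

  \<comment> \<open>\<open>\<phi>\<close> is the tangent angle relative to that of the unit circle.\<close>
  define \<phi> where "\<phi> = (\<lambda>s. integral {0..s} f)"
  have d\<phi>: "(\<phi> has_real_derivative f s) (at s within ?J)" if "s \<in> ?J" for s
    unfolding \<phi>_def by (rule integral_has_real_derivative[OF cf that])
  have \<phi>_ends: "\<phi> 0 = \<phi> (2 * pi)" using f0 by (simp add: \<phi>_def)
  have c\<phi>: "continuous_on ?J \<phi>" using d\<phi> DERIV_continuous_on by blast
  \<comment> \<open>Since \<open>\<phi>\<close> is closed, twice its oscillation is at most the
    integral of \<open>\<bar>f\<bar>\<close>, whose square is at most \<open>2 * pi * X\<close>; and
    \<open>X \<le> Y < pi\<close>.\<close>
  have osc: "(\<phi> x - \<phi> y)\<^sup>2 \<le> pi\<^sup>2 / 2" if "x \<in> ?J" "y \<in> ?J" for x y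
  proof -
    have "(2 * \<bar>\<phi> x - \<phi> y\<bar>)\<^sup>2 \<le> (integral ?J (\<lambda>s. \<bar>f s\<bar>))\<^sup>2"
      by (intro power_mono closed_oscillation_bound[OF d\<phi> cf \<phi>_ends that]) auto
    also have "\<dots> \<le> integral ?J (\<lambda>s. 1\<^sup>2) * integral ?J (\<lambda>s. \<bar>f s\<bar>\<^sup>2)"
      using integral_Cauchy_Schwarz[of 0 "2 * pi" "\<lambda>_. 1" "\<lambda>s. \<bar>f s\<bar>"] cf
      by (simp add: continuous_intros)
    also have "\<dots> = 2 * pi * X" by (simp add: X_def)
    also have "\<dots> \<le> 2 * pi * pi" using XY Y by simp
    finally show ?thesis by (simp add: power2_eq_square)
  qed
  \<comment> \<open>Subtracting the mean makes the integral of \<open>\<psi>\<close> vanish, so that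
    no mean term is lost when \<open>integral_double_dist\<close> is applied to
    \<open>\<psi>\<close>.\<close>
  define m where "m = integral ?J \<phi> / (2 * pi)"
  define \<psi> where "\<psi> = (\<lambda>s. \<phi> s - m)"
  define \<Psi> where "\<Psi> = integral ?J (\<lambda>s. (\<psi> s)\<^sup>2)"
  have c\<psi>: "continuous_on ?J \<psi>" unfolding \<psi>_def by (intro continuous_intros c\<phi>)
  have \<psi>0: "integral ?J \<psi> = 0"
    unfolding \<psi>_def by (subst integral_diff) (auto intro!: integrable_continuous_real c\<phi> simp: m_def)
  have d\<psi>: "(\<psi> has_real_derivative f s) (at s within ?J)" if "s \<in> ?J" for s
    unfolding \<psi>_def using d\<phi>[OF that] by (auto intro!: derivative_eq_intros)
  \<comment> \<open>Integration by parts on the circle: \<open>f\<close> is the derivative of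
    \<open>\<psi>\<close>, so \<open>X\<close> equals minus the integral of
    \<open>\<kappa>' * \<psi>\<close>; then Cauchy-Schwarz.\<close>
  have X2: "X\<^sup>2 \<le> Y * \<Psi>"
  proof -
    have 0: "((\<lambda>s. f s * f s + \<kappa>' s * \<psi> s) has_integral 0) ?J"
    proof (rule integral_deriv_closed)
      fix s assume s: "s \<in> ?J"
      show "((\<lambda>s. f s * \<psi> s) has_vector_derivative f s * f s + \<kappa>' s * \<psi> s) (at s within ?J)"
        using has_vector_derivative_mult[OF df[THEN DERIV_subset[OF _ subset_UNIV], unfolded has_real_derivative_iff_has_vector_derivative]
          d\<psi>[OF s, unfolded has_real_derivative_iff_has_vector_derivative]] .
    qed (use f_ends \<phi>_ends in \<open>auto simp: \<psi>_def\<close>)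
    have "((\<lambda>s. f s * f s + \<kappa>' s * \<psi> s) has_integral X + integral ?J (\<lambda>s. \<kappa>' s * \<psi> s)) ?J"
      unfolding X_def power2_eq_square
      by (intro has_integral_add integrable_integral integrable_continuous_real continuous_intros cf c\<psi> c\<kappa>'S)
    from has_integral_unique[OF this 0] have "X = - integral ?J (\<lambda>s. \<kappa>' s * \<psi> s)" by simp
    then show ?thesis
      unfolding Y_def \<Psi>_def using integral_Cauchy_Schwarz[OF c\<kappa>'S c\<psi>] by simp
  qed

  \<comment> \<open>The tangent turns at rate \<open>\<kappa> = 1 + f\<close>, so turning it back by
    the angle \<open>s + \<phi> s\<close> leaves a constant.\<close>
  have w: "w s = w 0 * cis (\<phi> s)" if "s \<in> ?J" for s
  proof -
    have "((\<lambda>s. cis (- s - \<phi> s) * T s) has_vector_derivative 0) (at s within ?J)" if "s \<in> ?J" for s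
    proof -
      have "((\<lambda>s. - s - \<phi> s) has_real_derivative - 1 - f s) (at s within ?J)"
        using d\<phi>[OF that] by (auto intro!: derivative_eq_intros)
      from has_vector_derivative_mult[OF has_vector_derivative_cis[OF this] T[of s, THEN has_vector_derivative_at_within]]
      show ?thesis
        by (rule has_vector_derivative_eq_rhs) (simp add: f_def algebra_simps)
    qed
    then obtain c where c: "\<And>s. s \<in> ?J \<Longrightarrow> cis (- s - \<phi> s) * T s = c"
      using has_vector_derivative_zero_constant[OF convex_real_interval(5)] by blast
    have w_eq: "w s = cis (\<phi> s) * c" if "s \<in> ?J" for s
      unfolding w_def c[OF that, symmetric] mult.assoc[symmetric] cis_mult by simp
    have "w 0 = c" using w_eq[of 0] by (simp add: \<phi>_def)
    then show ?thesis using w_eq[OF \<open>s \<in> ?J\<close>] by simp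
  qed
  have w0: "norm (w 0) = 1" by (simp add: w_def unit)
  \<comment> \<open>This is \<open>1 - \<alpha>\<^sup>2 / 12\<close> at the largest oscillation
    \<open>\<alpha>\<^sup>2 = pi\<^sup>2 / 2\<close> allowed by \<open>osc\<close>: the worst ratio
    of squared chord to squared arc.\<close>
  define q where "q = 1 - pi\<^sup>2 / 24"
  have chord: "q * (norm (\<psi> x - \<psi> y))\<^sup>2 \<le> (norm (w x - w y))\<^sup>2" if "x \<in> ?J" "y \<in> ?J" for x y
  proof -
    define \<alpha> where "\<alpha> = \<phi> x - \<phi> y"
    have "(norm (w x - w y))\<^sup>2 = (norm (cis (\<phi> x) - cis (\<phi> y)))\<^sup>2"
      unfolding w[OF that(1)] w[OF that(2)] right_diff_distrib[symmetric] norm_mult w0 by simp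
    also have "\<dots> = 2 - 2 * cos \<alpha>"
      unfolding power2_norm_diff by (simp add: inner_complex_def cos_diff \<alpha>_def)
    also have "\<dots> \<ge> \<alpha>\<^sup>2 - \<alpha> ^ 4 / 12"
      using cos_le_quartic[of \<alpha>] by simp
    also have "\<alpha>\<^sup>2 - \<alpha> ^ 4 / 12 = \<alpha>\<^sup>2 * (1 - \<alpha>\<^sup>2 / 12)"
      by (simp add: algebra_simps power2_eq_square power4_eq_xxxx)
    also have "\<dots> \<ge> \<alpha>\<^sup>2 * q"
      using osc[OF that] by (intro mult_left_mono) (auto simp: q_def \<alpha>_def)
    finally show ?thesis by (simp add: \<alpha>_def \<psi>_def mult.commute)
  qed
  obtain a where a: "integral ?J (\<lambda>s. (norm (w s - a))\<^sup>2) \<le> 1 / (18 * pi)"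
  proof (rule unit_speed_isoperimetric[OF z continuous_on_T unit per(1)])
    fix a
    assume "integral ?J (\<lambda>s. (norm (cis (- s) * T s - a))\<^sup>2)
      \<le> 2 * (2 * pi - integral ?J (\<lambda>s. Im (cnj (z s) * T s)))"
    from order_trans[OF this area] show ?thesis by (rule that[unfolded w_def])
  qed
  have cw: "continuous_on ?J w"
    unfolding w_def
    by (intro continuous_on_mult continuous_on_T continuous_on_cis continuous_on_minus continuous_on_id)
  \<comment> \<open>\<open>chord\<close> is integrated over all pairs of points. The constant
    \<open>a\<close> cancels in the differences of \<open>w\<close>; the subtracted square of the
    mean of \<open>w - a\<close> is dropped, while on the left it vanishes by
    \<open>\<psi>0\<close>.\<close>
  have q\<Psi>: "q * \<Psi> \<le> 1 / (18 * pi)"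
  proof -
    let ?W = "integral ?J (\<lambda>s. (norm (w s - a))\<^sup>2)"
    have "q * (2 * (2 * pi - 0) * integral ?J (\<lambda>x. (norm (\<psi> x))\<^sup>2) - 2 * (norm (integral ?J \<psi>))\<^sup>2)
      \<le> 2 * (2 * pi - 0) * ?W - 2 * (norm (integral ?J (\<lambda>s. w s - a)))\<^sup>2"
    proof (rule has_integral_le)
      show "((\<lambda>x. q * integral ?J (\<lambda>y. (norm (\<psi> x - \<psi> y))\<^sup>2)) has_integral
          q * (2 * (2 * pi - 0) * integral ?J (\<lambda>x. (norm (\<psi> x))\<^sup>2) - 2 * (norm (integral ?J \<psi>))\<^sup>2)) ?J"
        by (intro has_integral_mult_right integral_double_dist c\<psi>) auto
      show "((\<lambda>x. integral ?J (\<lambda>y. (norm ((w x - a) - (w y - a)))\<^sup>2)) has_integral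
          2 * (2 * pi - 0) * ?W - 2 * (norm (integral ?J (\<lambda>s. w s - a)))\<^sup>2) ?J"
        by (intro integral_double_dist continuous_intros cw) auto
      fix x assume x: "x \<in> ?J"
      have "integral ?J (\<lambda>y. q * (norm (\<psi> x - \<psi> y))\<^sup>2) \<le> integral ?J (\<lambda>y. (norm (w x - w y))\<^sup>2)"
        using chord[OF x]
        by (intro integral_le integrable_continuous_real continuous_intros c\<psi> cw) auto
      then show "q * integral ?J (\<lambda>y. (norm (\<psi> x - \<psi> y))\<^sup>2) \<le> integral ?J (\<lambda>y. (norm ((w x - a) - (w y - a)))\<^sup>2)"
        by simp
    qed
    also have "\<dots> \<le> 4 * pi * ?W" by simp
    also have "\<dots> \<le> 4 * pi * (1 / (18 * pi))" using a by (intro mult_left_mono) auto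
    also have "q * (2 * (2 * pi - 0) * integral ?J (\<lambda>x. (norm (\<psi> x))\<^sup>2) - 2 * (norm (integral ?J \<psi>))\<^sup>2)
        = 4 * pi * (q * \<Psi>)"
      unfolding \<psi>0 \<Psi>_def by simp
    finally have "4 * pi * (q * \<Psi>) \<le> 4 * pi * (1 / (18 * pi))" .
    then show ?thesis by (subst (asm) mult_le_cancel_left_pos) auto
  qed

  have \<Psi>: "0 \<le> \<Psi>"
    unfolding \<Psi>_def by (auto intro!: integral_nonneg integrable_continuous_real continuous_intros c\<psi>)
  \<comment> \<open>At 72/7 the value \<open>q = 1 - pi\<^sup>2 / 24\<close> would equal
    \<open>pi\<^sup>2 / 18\<close>. The chain below ends in \<open>q \<le> pi\<^sup>2 / 18\<close>,
    which this bound refutes.\<close>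
  have pi2: "pi\<^sup>2 < 72 / 7"
  proof -
    have "pi\<^sup>2 < (16 / 5)\<^sup>2" using pi_less_16_5 by (intro power_strict_mono) auto
    then show ?thesis by (simp add: power2_eq_square)
  qed
  then have q: "0 < q" by (simp add: q_def)
  have "1\<^sup>2 \<le> (X * Y)\<^sup>2" using one_le by (intro power_mono) auto
  also have "\<dots> \<le> (Y * \<Psi>) * Y\<^sup>2"
    unfolding power_mult_distrib by (intro mult_right_mono X2) auto
  also have "\<dots> = Y ^ 3 * \<Psi>" by (simp add: power2_eq_square power3_eq_cube)
  also have "\<dots> \<le> pi ^ 3 * \<Psi>"
    using Y pos \<Psi> by (intro mult_right_mono power_mono) auto
  finally have "q * 1 \<le> q * (pi ^ 3 * \<Psi>)" using q by (intro mult_left_mono) auto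
  also have "\<dots> = pi ^ 3 * (q * \<Psi>)" by simp
  also have "\<dots> \<le> pi ^ 3 * (1 / (18 * pi))" by (intro mult_left_mono q\<Psi>) auto
  also have "\<dots> = pi\<^sup>2 / 18" by (simp add: power2_eq_square power3_eq_cube)
  finally show False using pi2 by (simp add: q_def)
qed

end

section \<open>Curvature of a closed regular curve\<close>

lemma has_real_derivative_norm:
  fixes f :: "real \<Rightarrow> 'a::real_inner"
  assumes f: "(f has_vector_derivative f') (at x within S)" and nz: "f x \<noteq> 0"
  shows "((\<lambda>x. norm (f x)) has_real_derivative (f x \<bullet> f') / norm (f x)) (at x within S)"
proof -
  have "((\<lambda>x. f x \<bullet> f x) has_vector_derivative f x \<bullet> f' + f' \<bullet> f x) (at x within S)"
    by (rule bounded_bilinear.has_vector_derivative[OF bounded_bilinear_inner f f])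
  then have *: "((\<lambda>x. f x \<bullet> f x) has_real_derivative 2 * (f x \<bullet> f')) (at x within S)"
    by (simp add: has_real_derivative_iff_has_vector_derivative inner_commute)
  have "f x \<bullet> f x > 0" using nz by simp
  from DERIV_chain2[OF DERIV_real_sqrt[OF this] *] show ?thesis
    unfolding norm_eq_sqrt_inner by (rule DERIV_cong) (simp add: field_simps)
qed

text \<open>All parameter derivatives are supplied as explicit functions \<open>G n\<close>. In a
  family of curves \<open>G\<close> becomes the sequence of spatial partial derivatives at a fixed
  time.\<close>

locale closed_curve_jet =
  fixes \<gamma> :: "real \<Rightarrow> complex" and G :: "nat \<Rightarrow> real \<Rightarrow> complex"
  assumes jet_0: "G 0 = \<gamma>"
    and jet_deriv: "\<And>n u. (G n has_vector_derivative G (Suc n) u) (at u)"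
    and period: "\<And>u. \<gamma> (u + 2 * pi) = \<gamma> u"
    and jet_1_nonzero: "\<And>u. G 1 u \<noteq> 0"
begin

text \<open>With the speed \<open>p\<close>, the curvature is \<open>N / p\<^sup>3\<close>; primes denote derivatives in the parameter.\<close>

definition p where "p u = norm (G 1 u)"
definition p' where "p' u = (G 1 u \<bullet> G 2 u) / p u"
definition N where "N u = Im (cnj (G 1 u) * G 2 u)"
definition N' where "N' u = Im (cnj (G 1 u) * G 3 u)"
definition k' where "k' u = (N' u * p u - 3 * N u * p' u) / p u ^ 4"

lemma deriv_curve: "(\<gamma> has_vector_derivative G 1 u) (at u)"
  using jet_deriv[of 0 u] by (simp add: jet_0)

lemma jet_deriv_1: "(G 1 has_vector_derivative G 2 u) (at u)"
  using jet_deriv[of 1 u] by (simp add: numeral_2_eq_2)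

lemma jet_deriv_2: "(G 2 has_vector_derivative G 3 u) (at u)"
  using jet_deriv[of 2 u] by (simp add: numeral_3_eq_3)

lemma continuous_jet: "continuous_on S (G n)"
  by (rule continuous_on_vector_derivative[OF jet_deriv[THEN has_vector_derivative_at_within]])

lemma speed_eq: "speed \<gamma> u = p u"
  unfolding speed_def p_def vector_derivative_at[OF deriv_curve] ..

lemma p_pos: "p u > 0"
  using jet_1_nonzero[of u] by (simp add: p_def)

lemma tangent_eq: "arc_deriv \<gamma> \<gamma> u = G 1 u /\<^sub>R p u"
  unfolding arc_deriv_def speed_eq vector_derivative_at[OF deriv_curve] ..

lemma p_deriv: "(p has_real_derivative p' u) (at u)"
  unfolding p_def[abs_def] p'_def by (rule has_real_derivative_norm[OF jet_deriv_1 jet_1_nonzero])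

lemma N_deriv: "(N has_real_derivative N' u) (at u)"
proof -
  \<comment> \<open>The second summand is real, which is why \<open>N'\<close> contains only the
    first.\<close>
  have "((\<lambda>u. Im (cnj (G 1 u) * G 2 u)) has_vector_derivative
      Im (cnj (G 1 u) * G 3 u + cnj (G 2 u) * G 2 u)) (at u)"
    by (intro bounded_linear.has_vector_derivative[OF bounded_linear_Im] has_vector_derivative_mult
        bounded_linear.has_vector_derivative[OF bounded_linear_cnj] jet_deriv_1 jet_deriv_2)
  then show ?thesis
    by (simp add: has_real_derivative_iff_has_vector_derivative N_def[abs_def] N'_def algebra_simps)
qed

lemma norm_tangent: "norm (arc_deriv \<gamma> \<gamma> u) = 1"
  using p_pos[of u] by (simp add: tangent_eq p_def)

lemma tangent_deriv_N:
  "(arc_deriv \<gamma> \<gamma> has_vector_derivative of_real (N u / (p u)\<^sup>2) * (\<i> * arc_deriv \<gamma> \<gamma> u)) (at u)"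
proof -
  have "((\<lambda>u. inverse (p u)) has_real_derivative - (inverse (p u) * p' u * inverse (p u))) (at u)"
    using p_pos[of u] by (intro DERIV_inverse' p_deriv) auto
  from has_vector_derivative_scaleR[OF this jet_deriv_1]
  have "(arc_deriv \<gamma> \<gamma> has_vector_derivative
      inverse (p u) *\<^sub>R G 2 u + (- (inverse (p u) * p' u * inverse (p u))) *\<^sub>R G 1 u) (at u)"
    by (simp add: tangent_eq[abs_def])
  moreover have "inverse (p u) *\<^sub>R G 2 u + (- (inverse (p u) * p' u * inverse (p u))) *\<^sub>R G 1 u
      = of_real (N u / (p u)\<^sup>2) * (\<i> * arc_deriv \<gamma> \<gamma> u)"
  proof -
    have nz: "of_real (p u) \<noteq> (0::complex)" using p_pos[of u] by simp
    \<comment> \<open>This splits the acceleration along the velocity and its rotation. The part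
      with \<open>p'\<close> is the change of speed and cancels against the derivative of
      \<open>1 / p\<close>.\<close>
    have "of_real ((p u)\<^sup>2) * G 2 u = G 1 u * (cnj (G 1 u) * G 2 u)"
      by (simp only: p_def mult.assoc[symmetric] complex_norm_square)
    also have "cnj (G 1 u) * G 2 u = of_real (p u * p' u) + \<i> * of_real (N u)"
      using p_pos[of u] by (simp add: complex_eq_iff N_def p'_def inner_complex_def)
    finally have "(of_real (p u))\<^sup>2 * G 2 u = G 1 u * (of_real (p u) * of_real (p' u) + \<i> * of_real (N u))"
      by simp
    with nz show ?thesis
      by (simp add: tangent_eq scaleR_conv_of_real field_simps power2_eq_square)
  qed
  ultimately show ?thesis by simp
qed

lemma curvature_eq: "curvature \<gamma> u = N u / p u ^ 3"
proof -
  define T where "T = arc_deriv \<gamma> \<gamma> u"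
  have "(\<i> * T) \<bullet> (\<i> * T) = 1"
    using norm_tangent[of u] by (simp add: T_def flip: power2_norm_eq_inner) (simp add: norm_mult)
  moreover have "curvature \<gamma> u = (N u / (p u)\<^sup>2 / p u) * ((\<i> * T) \<bullet> (\<i> * T))"
    unfolding curvature_def unit_normal_def arc_deriv_def[of \<gamma> "arc_deriv \<gamma> \<gamma>"]
      vector_derivative_at[OF tangent_deriv_N] speed_eq T_def[symmetric]
      scaleR_conv_of_real[symmetric] inner_scaleR_left
    by (simp add: field_simps)
  ultimately show ?thesis by (simp add: power2_eq_square power3_eq_cube)
qed

lemma tangent_deriv:
  "(arc_deriv \<gamma> \<gamma> has_vector_derivative of_real (curvature \<gamma> u * speed \<gamma> u) * (\<i> * arc_deriv \<gamma> \<gamma> u)) (at u)"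
proof -
  have "curvature \<gamma> u * speed \<gamma> u = N u / (p u)\<^sup>2"
    using p_pos[of u] by (simp add: curvature_eq speed_eq power2_eq_square power3_eq_cube)
  then show ?thesis using tangent_deriv_N by simp
qed

lemma curvature_deriv_k': "(curvature \<gamma> has_real_derivative k' u) (at u)"
proof -
  have "((\<lambda>u. N u / p u ^ 3) has_real_derivative
     (N' u * p u ^ 3 - N u * (real 3 * (p' u * p u ^ (3 - Suc 0)))) / (p u ^ 3 * p u ^ 3)) (at u)"
    using p_pos[of u] by (intro DERIV_divide DERIV_power N_deriv p_deriv) auto
  moreover have "(N' u * p u ^ 3 - N u * (real 3 * (p' u * p u ^ (3 - Suc 0)))) / (p u ^ 3 * p u ^ 3) = k' u"
    using p_pos[of u] by (simp add: k'_def field_simps eval_nat_numeral)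
  ultimately show ?thesis by (simp add: curvature_eq[abs_def])
qed

lemma arc_deriv_curvature_eq: "arc_deriv \<gamma> (curvature \<gamma>) u = k' u / p u"
  unfolding arc_deriv_def speed_eq
    vector_derivative_at[OF curvature_deriv_k'[unfolded has_real_derivative_iff_has_vector_derivative]]
  by (simp add: divide_inverse mult.commute)

lemma curvature_deriv:
  "(curvature \<gamma> has_real_derivative arc_deriv \<gamma> (curvature \<gamma>) u * speed \<gamma> u) (at u)"
  using curvature_deriv_k'[of u] p_pos[of u] by (simp add: arc_deriv_curvature_eq speed_eq)

lemma continuous_speed: "continuous_on S (speed \<gamma>)"
  unfolding speed_eq[abs_def] p_def by (intro continuous_intros continuous_jet)

lemma speed_pos: "0 < speed \<gamma> u"
  by (simp add: speed_eq p_pos)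

lemma continuous_tangent: "continuous_on S (arc_deriv \<gamma> \<gamma>)"
  by (rule continuous_on_vector_derivative[OF tangent_deriv[THEN has_vector_derivative_at_within]])

lemma continuous_curvature: "continuous_on S (curvature \<gamma>)"
  by (rule DERIV_continuous_on[OF curvature_deriv[THEN DERIV_subset[OF _ subset_UNIV]]])

text \<open>The right-hand side is the derivative by definition of \<open>arc_deriv\<close>, so only
  differentiability has to be shown and no formula for the second arc length derivative of the
  curvature is computed.\<close>

lemma arc_deriv_curvature_deriv:
  "(arc_deriv \<gamma> (curvature \<gamma>) has_real_derivative
     arc_deriv \<gamma> (arc_deriv \<gamma> (curvature \<gamma>)) u * speed \<gamma> u) (at u)"
proof -
  have p: "p differentiable (at u)" and N: "N differentiable (at u)"
    using p_deriv N_deriv by (auto simp: real_differentiable_def)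
  have G: "G n differentiable (at u)" for n
    by (rule differentiableI_vector[OF jet_deriv])
  have nz: "p u \<noteq> 0" using p_pos[of u] by simp
  have "((\<lambda>u. Im (cnj (G 1 u) * G 3 u)) has_vector_derivative
      Im (cnj (G 1 u) * G (Suc 3) u + cnj (G 2 u) * G 3 u)) (at u)"
    by (intro bounded_linear.has_vector_derivative[OF bounded_linear_Im] has_vector_derivative_mult
        bounded_linear.has_vector_derivative[OF bounded_linear_cnj] jet_deriv_1 jet_deriv)
  then have N': "N' differentiable (at u)"
    unfolding N'_def[abs_def] by (rule differentiableI_vector)
  have p': "p' differentiable (at u)"
    unfolding p'_def[abs_def] by (intro differentiable_divide differentiable_inner G p nz)
  have "(\<lambda>u. k' u / p u) differentiable (at u)"
    unfolding k'_def by (intro derivative_intros p N N' p' nz) (use nz in auto)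
  then have "(arc_deriv \<gamma> (curvature \<gamma>) has_vector_derivative
      vector_derivative (arc_deriv \<gamma> (curvature \<gamma>)) (at u)) (at u)"
    unfolding arc_deriv_curvature_eq[abs_def] by (simp add: vector_derivative_works)
  then show ?thesis
    unfolding has_real_derivative_iff_has_vector_derivative
    using speed_pos[of u] by (simp add: arc_deriv_def[of \<gamma> "arc_deriv \<gamma> (curvature \<gamma>)"] field_simps)
qed

lemma continuous_arc_deriv_curvature: "continuous_on S (arc_deriv \<gamma> (curvature \<gamma>))"
  by (rule DERIV_continuous_on[OF arc_deriv_curvature_deriv[THEN DERIV_subset[OF _ subset_UNIV]]])

lemma jet_period: "G n (u + 2 * pi) = G n u"
proof (induction n arbitrary: u)
  case 0
  then show ?case by (simp add: jet_0 period)
next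
  case (Suc n)
  have "((\<lambda>u. G n (u + 2 * pi)) has_vector_derivative G (Suc n) (u + 2 * pi)) (at u)"
  proof -
    have "((\<lambda>u. u + 2 * pi) has_vector_derivative 1) (at u)"
      by (auto intro!: derivative_eq_intros)
    from vector_diff_chain_at[OF this jet_deriv] show ?thesis by (simp add: o_def)
  qed
  then show ?case
    using jet_deriv[of n u] unfolding Suc by (rule vector_derivative_unique_at)
qed

lemma speed_period: "speed \<gamma> (u + 2 * pi) = speed \<gamma> u"
  by (simp add: speed_eq p_def jet_period)

lemma curvature_period: "curvature \<gamma> (u + 2 * pi) = curvature \<gamma> u"
  by (simp add: curvature_eq p_def N_def jet_period)

lemma tangent_period: "arc_deriv \<gamma> \<gamma> (u + 2 * pi) = arc_deriv \<gamma> \<gamma> u"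
  by (simp add: tangent_eq p_def jet_period)

lemma arc_deriv_curvature_period: "arc_deriv \<gamma> (curvature \<gamma>) (u + 2 * pi) = arc_deriv \<gamma> (curvature \<gamma>) u"
  by (simp add: arc_deriv_curvature_eq k'_def p_def p'_def N_def N'_def jet_period)

end

section \<open>Arc length parametrisation\<close>

lemma real_antiderivative:
  fixes f :: "real \<Rightarrow> real"
  assumes f: "continuous_on UNIV f"
  obtains F where "\<And>x. (F has_real_derivative f x) (at x)" "F 0 = 0"
proof -
  \<comment> \<open>For \<open>x \<noteq> 0\<close> one of the two intervals is empty and
    contributes 0, so this is the oriented integral on the whole line.\<close>
  define F where "F = (\<lambda>x. integral {0..x} f - integral {x..0} f)"
  have i: "f integrable_on {a..b}" for a b
    by (intro integrable_continuous_real continuous_on_subset[OF f]) auto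
  have "(F has_real_derivative f x) (at x)" for x
  proof -
    define n where "n = \<bar>x\<bar> + 1"
    have x: "x \<in> {-n<..<n}" by (auto simp: n_def)
    have eq: "F y = integral {-n..y} f - integral {-n..0} f" if "y \<in> {-n<..<n}" for y
      using that Henstock_Kurzweil_Integration.integral_combine[OF _ _ i, of "-n" 0 y] Henstock_Kurzweil_Integration.integral_combine[OF _ _ i, of "-n" y 0]
      by (cases "0 \<le> y"; cases "y = 0") (auto simp: F_def)
    have "((\<lambda>y. integral {-n..y} f) has_real_derivative f x) (at x within {-n..n})"
      using x by (intro integral_has_real_derivative continuous_on_subset[OF f]) auto
    then have "((\<lambda>y. integral {-n..y} f) has_real_derivative f x) (at x)"
      using x at_within_Icc_at[of "-n" x n] by auto
    then have "((\<lambda>y. integral {-n..y} f - integral {-n..0} f) has_real_derivative f x) (at x)"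
      by (auto intro!: derivative_eq_intros)
    then show ?thesis
      by (rule has_field_derivative_transform_within_open[OF _ open_greaterThanLessThan x]) (simp add: eq)
  qed
  moreover have "F 0 = 0" by (simp add: F_def)
  ultimately show ?thesis using that by blast
qed

lemma periodic_representative:
  fixes f :: "real \<Rightarrow> 'a"
  assumes "\<And>x. f (x + 2 * pi) = f x"
  obtains y where "y \<in> {0..2 * pi}" "f y = f x"
proof -
  interpret periodic_fun_simple f "2 * pi"
    using assms by unfold_locales
  define n where "n = \<lfloor>x / (2 * pi)\<rfloor>"
  have "of_int n \<le> x / (2 * pi)" "x / (2 * pi) \<le> of_int n + 1"
    unfolding n_def by linarith+
  then have "of_int n * (2 * pi) \<le> x" "x \<le> (of_int n + 1) * (2 * pi)"
    by (simp_all add: pos_le_divide_eq pos_divide_le_eq)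
  then have "x - of_int n * (2 * pi) \<in> {0..2 * pi}"
    by (simp add: algebra_simps)
  moreover have "f (x - of_int n * (2 * pi)) = f x"
    by (rule minus_of_int)
  ultimately show ?thesis by (rule that)
qed

lemma arc_integral_cmult: "arc_integral \<gamma> (\<lambda>u. c * f u) = c * arc_integral \<gamma> f"
  by (simp add: arc_integral_def mult.assoc)

context closed_curve_jet
begin

lemma curve_length_pos: "0 < curve_length \<gamma>"
proof -
  have "integral {0..2 * pi} (\<lambda>u. 0) < integral {0..2 * pi} (speed \<gamma>)"
    by (rule integral_less_real) (use pi_gt_zero in \<open>auto simp: continuous_speed speed_pos simp del: pi_gt_zero\<close>)
  then show ?thesis by (simp add: curve_length_def arc_integral_def)
qed

text \<open>\<open>U\<close> inverts the arc length \<open>\<sigma>\<close>, rescaled so that one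
  turn of the curve has length \<open>2 * pi\<close>. As \<open>\<sigma>\<close> commutes with the
  shift by \<open>2 * pi\<close>, so does \<open>U\<close>.\<close>

lemma arclength_reparametrization:
  obtains U where
    "\<And>s. (U has_real_derivative curve_length \<gamma> / (2 * pi * speed \<gamma> (U s))) (at s)"
    "\<And>s. U (s + 2 * pi) = U s + 2 * pi"
    "\<And>u. \<exists>s. U s = u"
    "\<And>F. continuous_on {0..2 * pi} F \<Longrightarrow>
       integral {0..2 * pi} (\<lambda>s. F (U s)) = 2 * pi / curve_length \<gamma> * arc_integral \<gamma> F"
proof -
  define L where "L = curve_length \<gamma>"
  have L: "L > 0" using curve_length_pos by (simp add: L_def)
  define \<sigma>' where "\<sigma>' = (\<lambda>u. 2 * pi / L * speed \<gamma> u)"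
  have \<sigma>'_pos: "\<sigma>' u > 0" for u using L speed_pos[of u] by (simp add: \<sigma>'_def)
  have c\<sigma>': "continuous_on S \<sigma>'" for S
    unfolding \<sigma>'_def by (intro continuous_intros continuous_speed)
  obtain \<sigma> where \<sigma>: "\<And>u. (\<sigma> has_real_derivative \<sigma>' u) (at u)" and \<sigma>0: "\<sigma> 0 = 0"
    using real_antiderivative[OF c\<sigma>'] by blast
  have \<sigma>_cont: "isCont \<sigma> u" for u using \<sigma> DERIV_isCont by blast
  have c\<sigma>: "continuous_on S \<sigma>" for S
    using \<sigma>_cont continuous_at_imp_continuous_on by blast
  have \<sigma>2pi: "\<sigma> (2 * pi) = 2 * pi"
  proof -
    have "(\<sigma>' has_integral (\<sigma> (2 * pi) - \<sigma> 0)) {0..2 * pi}"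
      using \<sigma>[unfolded has_real_derivative_iff_has_vector_derivative, THEN has_vector_derivative_at_within]
      by (intro fundamental_theorem_of_calculus) auto
    then have "\<sigma> (2 * pi) = integral {0..2 * pi} \<sigma>'"
      using integral_unique[of \<sigma>' "\<sigma> (2 * pi)"] \<sigma>0 by simp
    also have "\<dots> = 2 * pi / L * L"
      by (simp add: \<sigma>'_def L_def curve_length_def arc_integral_def)
    finally show ?thesis using L by simp
  qed
  have \<sigma>_per: "\<sigma> (u + 2 * pi) = \<sigma> u + 2 * pi" for u
  proof -
    have "((\<lambda>u. \<sigma> (u + 2 * pi) - \<sigma> u) has_real_derivative 0) (at u within UNIV)" for u
    proof -
      have "((\<lambda>u. \<sigma> (u + 2 * pi)) has_real_derivative \<sigma>' (u + 2 * pi)) (at u)"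
        using \<sigma>[of "u + 2 * pi"] DERIV_shift by blast
      moreover have "\<sigma>' (u + 2 * pi) = \<sigma>' u" by (simp add: \<sigma>'_def speed_period)
      ultimately show ?thesis using \<sigma>[of u] by (auto intro!: derivative_eq_intros)
    qed
    then obtain c where "\<And>u. \<sigma> (u + 2 * pi) - \<sigma> u = c"
      using has_field_derivative_zero_constant[of UNIV "\<lambda>u. \<sigma> (u + 2 * pi) - \<sigma> u"] by auto
    from this[of 0] this[of u] show ?thesis using \<sigma>0 \<sigma>2pi by simp
  qed
  have mono: "strict_mono \<sigma>"
  proof (rule strict_monoI)
    show "\<sigma> x < \<sigma> y" if "x < y" for x y
      using that \<sigma> \<sigma>'_pos by (intro DERIV_pos_imp_increasing[OF that]) blast
  qed
  \<comment> \<open>Fixed points of arbitrarily large modulus on either side, so that the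
    intermediate value theorem makes \<open>\<sigma>\<close> surjective.\<close>
  have \<sigma>n: "\<sigma> (2 * pi * real n) = 2 * pi * real n" "\<sigma> (- (2 * pi * real n)) = - (2 * pi * real n)" for n
  proof (induction n)
    case (Suc n)
    show "\<sigma> (2 * pi * real (Suc n)) = 2 * pi * real (Suc n)"
      using \<sigma>_per[of "2 * pi * real n"] Suc by (simp add: algebra_simps)
    show "\<sigma> (- (2 * pi * real (Suc n))) = - (2 * pi * real (Suc n))"
      using \<sigma>_per[of "- (2 * pi * real (Suc n))"] Suc by (simp add: algebra_simps)
  qed (use \<sigma>0 in auto)
  have surj: "\<exists>u. \<sigma> u = s" for s
  proof -
    obtain n where "\<bar>s\<bar> / (2 * pi) \<le> real n" using real_arch_simple by blast
    then have n: "\<bar>s\<bar> \<le> 2 * pi * real n" by (simp add: pos_divide_le_eq mult.commute)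
    then have "\<sigma> (- (2 * pi * real n)) \<le> s" "s \<le> \<sigma> (2 * pi * real n)" unfolding \<sigma>n by linarith+
    moreover have "- (2 * pi * real n) \<le> 2 * pi * real n" by simp
    ultimately show ?thesis using IVT'[of \<sigma> "- (2 * pi * real n)" s "2 * pi * real n"] c\<sigma> by blast
  qed
  define U where "U = inv \<sigma>"
  have inj: "inj \<sigma>" using mono strict_mono_imp_inj_on by blast
  have U\<sigma>: "U (\<sigma> u) = u" for u by (simp add: U_def inj)
  have \<sigma>U: "\<sigma> (U s) = s" for s using surj[of s] U\<sigma> by metis
  have U_cont: "isCont U s" for s
  proof -
    have "isCont U (\<sigma> (U s))"
      by (rule isCont_inverse_function2[of "U s - 1" _ "U s + 1"]) (auto simp: U\<sigma> \<sigma>_cont)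
    then show ?thesis by (simp add: \<sigma>U)
  qed
  show ?thesis
  proof (rule that[of U])
    fix s
    have "(U has_real_derivative inverse (\<sigma>' (U s))) (at s)"
      using \<sigma>'_pos[of "U s"]
      by (intro DERIV_inverse_function[where f = \<sigma> and a = "s - 1" and b = "s + 1"] \<sigma> U_cont)
        (auto simp: \<sigma>U)
    then show "(U has_real_derivative curve_length \<gamma> / (2 * pi * speed \<gamma> (U s))) (at s)"
      by (simp add: \<sigma>'_def L_def inverse_eq_divide)
    show "U (s + 2 * pi) = U s + 2 * pi"
      using U\<sigma>[of "U s + 2 * pi"] by (simp add: \<sigma>_per \<sigma>U)
  next
    show "\<exists>s. U s = u" for u using U\<sigma> by blast
  next
    fix F :: "real \<Rightarrow> real" assume F: "continuous_on {0..2 * pi} F"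
    have U0: "U 0 = 0" "U (2 * pi) = 2 * pi" using U\<sigma>[of 0] U\<sigma>[of "2 * pi"] \<sigma>0 \<sigma>2pi by auto
    have monoU: "U s \<le> U t" if "s \<le> t" for s t
      using that strict_mono_less_eq[OF mono, of "U s" "U t"] by (simp add: \<sigma>U)
    have "((\<lambda>u. \<sigma>' u *\<^sub>R F (U (\<sigma> u))) has_integral integral {\<sigma> 0..\<sigma> (2 * pi)} (\<lambda>s. F (U s))) {0..2 * pi}"
    proof (rule has_integral_substitution)
      show "\<sigma> ` {0..2 * pi} \<subseteq> {0..2 * pi}"
        using strict_mono_less_eq[OF mono, of 0] strict_mono_less_eq[OF mono, of _ "2 * pi"]
        by (auto simp: \<sigma>0 \<sigma>2pi)
      have "continuous_on {0..2 * pi} U"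
        by (intro continuous_at_imp_continuous_on ballI U_cont)
      then show "continuous_on {0..2 * pi} (\<lambda>s. F (U s))"
        using monoU[of 0] monoU[of _ "2 * pi"] by (intro continuous_on_compose2[OF F]) (auto simp: U0)
      show "(\<sigma> has_real_derivative \<sigma>' u) (at u within {0..2 * pi})" for u
        using \<sigma> by (rule DERIV_subset) auto
    qed (auto simp: \<sigma>0 \<sigma>2pi)
    then have "integral {0..2 * pi} (\<lambda>s. F (U s)) = integral {0..2 * pi} (\<lambda>u. 2 * pi / L * (F u * speed \<gamma> u))"
      unfolding U\<sigma> \<sigma>0 \<sigma>2pi by (subst integral_unique) (auto simp: \<sigma>'_def mult_ac)
    then show "integral {0..2 * pi} (\<lambda>s. F (U s)) = 2 * pi / curve_length \<gamma> * arc_integral \<gamma> F"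
      unfolding arc_integral_def L_def by simp
  qed
qed

text \<open>The imaginary part is the determinant of position and tangent, as in Green's formula for
  the area.\<close>

lemma signed_area_eq: "signed_area \<gamma> = 1 / 2 * arc_integral \<gamma> (\<lambda>u. Im (cnj (\<gamma> u) * arc_deriv \<gamma> \<gamma> u))"
proof -
  have "Im (cnj (\<gamma> u) * arc_deriv \<gamma> \<gamma> u) = - (\<gamma> u \<bullet> unit_normal \<gamma> u)" for u
    by (simp add: unit_normal_def inner_complex_def)
  then show ?thesis
    unfolding signed_area_def arc_integral_def by (simp only: mult_minus_left integral_neg)
qed

text \<open>The curve is scaled by \<open>1 / r\<close> with \<open>r = L / (2 * pi)\<close>.
  Curvature gains a factor \<open>r\<close>, its arc length derivative gains
  \<open>r\<^sup>2\<close> and the line element loses \<open>r\<close>: hence total curvature is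
  unchanged and the energy scales as \<open>r ^ 4 / r\<close>. The third integral is twice the area
  of the scaled curve.\<close>

lemma normalised_reparametrization:
  defines "L \<equiv> curve_length \<gamma>"
  obtains z T \<kappa> \<kappa>' where
    "unit_speed_curve z T \<kappa> \<kappa>'"
    "integral {0..2 * pi} \<kappa> = arc_integral \<gamma> (curvature \<gamma>)"
    "integral {0..2 * pi} (\<lambda>s. Im (cnj (z s) * T s)) = 8 * pi\<^sup>2 / L\<^sup>2 * signed_area \<gamma>"
    "integral {0..2 * pi} (\<lambda>s. (\<kappa>' s)\<^sup>2)
       = (L / (2 * pi)) ^ 3 * arc_integral \<gamma> (\<lambda>u. (arc_deriv \<gamma> (curvature \<gamma>) u)\<^sup>2)"
    "(\<exists>u. curvature \<gamma> u \<le> 0) \<longrightarrow> (\<exists>s\<in>{0..2 * pi}. \<kappa> s \<le> 0)"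
proof -
  have L: "L > 0" using curve_length_pos by (simp add: L_def)
  define r where "r = L / (2 * pi)"
  have r: "r > 0" using L by (simp add: r_def)
  obtain U where U: "\<And>s. (U has_real_derivative r / speed \<gamma> (U s)) (at s)"
    and U_per: "\<And>s. U (s + 2 * pi) = U s + 2 * pi"
    and U_surj: "\<And>u. \<exists>s. U s = u"
    and subst: "\<And>F. continuous_on {0..2 * pi} F \<Longrightarrow>
       integral {0..2 * pi} (\<lambda>s. F (U s)) = 1 / r * arc_integral \<gamma> F"
  proof (rule arclength_reparametrization)
    fix U
    assume *: "\<And>s. (U has_real_derivative curve_length \<gamma> / (2 * pi * speed \<gamma> (U s))) (at s)"
      "\<And>s. U (s + 2 * pi) = U s + 2 * pi" "\<And>u. \<exists>s. U s = u"
      "\<And>F. continuous_on {0..2 * pi} F \<Longrightarrow>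
         integral {0..2 * pi} (\<lambda>s. F (U s)) = 2 * pi / curve_length \<gamma> * arc_integral \<gamma> F"
    show ?thesis
      by (rule that[of U]) (use * in \<open>simp_all add: r_def L_def\<close>)
  qed
  define z where "z = (\<lambda>s. (1 / r) *\<^sub>R \<gamma> (U s))"
  define T where "T = (\<lambda>s. arc_deriv \<gamma> \<gamma> (U s))"
  define \<kappa> where "\<kappa> = (\<lambda>s. r * curvature \<gamma> (U s))"
  define \<kappa>' where "\<kappa>' = (\<lambda>s. r\<^sup>2 * arc_deriv \<gamma> (curvature \<gamma>) (U s))"
  have chain: "((\<lambda>s. h (U s)) has_vector_derivative (r / speed \<gamma> (U s)) *\<^sub>R h') (at s)"
    if "(h has_vector_derivative h') (at (U s))" for h :: "real \<Rightarrow> 'b::real_normed_vector" and h' s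
    using vector_diff_chain_at[OF U[unfolded has_real_derivative_iff_has_vector_derivative] that]
    by (simp add: o_def)
  have nz: "speed \<gamma> u \<noteq> 0" for u using speed_pos[of u] by simp
  have cU: "continuous_on S U" for S
    by (rule DERIV_continuous_on[OF U[THEN DERIV_subset[OF _ subset_UNIV]]])
  have \<kappa>_per: "\<kappa> (s + 2 * pi) = \<kappa> s" for s by (simp add: \<kappa>_def U_per curvature_period)
  have c\<gamma>: "continuous_on S \<gamma>" for S using continuous_jet[of S 0] by (simp add: jet_0)
  show ?thesis
  proof (rule that[of z T \<kappa> \<kappa>'])
    show "unit_speed_curve z T \<kappa> \<kappa>'"
    proof
      fix s
      have "G 1 (U s) = speed \<gamma> (U s) *\<^sub>R T s"
        using p_pos[of "U s"] by (simp add: T_def tangent_eq speed_eq)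
      then show "(z has_vector_derivative T s) (at s)"
        unfolding z_def using nz[of "U s"] r
        by (intro has_vector_derivative_eq_rhs[OF has_vector_derivative_scaleR[OF DERIV_const chain[OF deriv_curve]]])
          simp
      show "(T has_vector_derivative of_real (\<kappa> s) * (\<i> * T s)) (at s)"
        unfolding T_def
        by (rule has_vector_derivative_eq_rhs[OF chain[OF tangent_deriv]])
          (use nz[of "U s"] in \<open>simp add: \<kappa>_def scaleR_conv_of_real\<close>)
      show "(\<kappa> has_real_derivative \<kappa>' s) (at s)"
      proof -
        have "((\<lambda>s. r * curvature \<gamma> (U s)) has_real_derivative
            r * (arc_deriv \<gamma> (curvature \<gamma>) (U s) * speed \<gamma> (U s) * (r / speed \<gamma> (U s)))) (at s)"
          by (intro DERIV_cmult DERIV_chain2[OF curvature_deriv U])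
        then show ?thesis using nz[of "U s"] by (simp add: \<kappa>_def[abs_def] \<kappa>'_def power2_eq_square mult_ac)
      qed
      show "norm (T s) = 1" by (simp add: T_def norm_tangent)
      show "z (s + 2 * pi) = z s" by (simp add: z_def U_per period)
      show "\<kappa> (s + 2 * pi) = \<kappa> s" by (rule \<kappa>_per)
    next
      show "continuous_on UNIV \<kappa>'"
        unfolding \<kappa>'_def
        by (intro continuous_intros continuous_on_compose2[OF continuous_arc_deriv_curvature cU]) auto
    qed
  next
    show "integral {0..2 * pi} \<kappa> = arc_integral \<gamma> (curvature \<gamma>)"
      using r by (simp add: \<kappa>_def subst continuous_curvature)
    have "integral {0..2 * pi} (\<lambda>s. Im (cnj (z s) * T s))
        = integral {0..2 * pi} (\<lambda>s. (\<lambda>u. 1 / r * Im (cnj (\<gamma> u) * arc_deriv \<gamma> \<gamma> u)) (U s))"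
      by (simp add: z_def T_def diff_divide_distrib add_divide_distrib)
    also have "\<dots> = 1 / r * arc_integral \<gamma> (\<lambda>u. 1 / r * Im (cnj (\<gamma> u) * arc_deriv \<gamma> \<gamma> u))"
      by (intro subst continuous_intros c\<gamma> continuous_tangent)
    also have "\<dots> = 8 * pi\<^sup>2 / L\<^sup>2 * signed_area \<gamma>"
      unfolding arc_integral_cmult signed_area_eq using L by (simp add: r_def power2_eq_square)
    finally show "integral {0..2 * pi} (\<lambda>s. Im (cnj (z s) * T s)) = 8 * pi\<^sup>2 / L\<^sup>2 * signed_area \<gamma>" .
    have "integral {0..2 * pi} (\<lambda>s. (\<kappa>' s)\<^sup>2)
        = integral {0..2 * pi} (\<lambda>s. (\<lambda>u. r ^ 4 * (arc_deriv \<gamma> (curvature \<gamma>) u)\<^sup>2) (U s))"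
      by (simp add: \<kappa>'_def power_mult_distrib)
    also have "\<dots> = 1 / r * arc_integral \<gamma> (\<lambda>u. r ^ 4 * (arc_deriv \<gamma> (curvature \<gamma>) u)\<^sup>2)"
      by (intro subst continuous_intros continuous_arc_deriv_curvature)
    also have "\<dots> = r ^ 3 * arc_integral \<gamma> (\<lambda>u. (arc_deriv \<gamma> (curvature \<gamma>) u)\<^sup>2)"
      unfolding arc_integral_cmult using r by (simp add: eval_nat_numeral)
    finally show "integral {0..2 * pi} (\<lambda>s. (\<kappa>' s)\<^sup>2)
       = (L / (2 * pi)) ^ 3 * arc_integral \<gamma> (\<lambda>u. (arc_deriv \<gamma> (curvature \<gamma>) u)\<^sup>2)"
      by (simp only: r_def)
    show "(\<exists>u. curvature \<gamma> u \<le> 0) \<longrightarrow> (\<exists>s\<in>{0..2 * pi}. \<kappa> s \<le> 0)"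
    proof (intro impI, elim exE)
      fix u assume u: "curvature \<gamma> u \<le> 0"
      obtain s where "U s = u" using U_surj by blast
      moreover obtain s' where "s' \<in> {0..2 * pi}" "\<kappa> s' = \<kappa> s"
        using periodic_representative[of \<kappa> s] \<kappa>_per by blast
      ultimately show "\<exists>s\<in>{0..2 * pi}. \<kappa> s \<le> 0" using u r by (intro bexI[of _ s']) (auto simp: \<kappa>_def mult_nonneg_nonpos)
    qed
  qed
qed

lemma isoperimetric_inequality: "signed_area \<gamma> \<le> (curve_length \<gamma>)\<^sup>2 / (4 * pi)"
proof -
  let ?L = "curve_length \<gamma>"
  note L = curve_length_pos
  obtain z T \<kappa> \<kappa>' where curve: "unit_speed_curve z T \<kappa> \<kappa>'"
    and total: "integral {0..2 * pi} \<kappa> = arc_integral \<gamma> (curvature \<gamma>)"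
    and area: "integral {0..2 * pi} (\<lambda>s. Im (cnj (z s) * T s)) = 8 * pi\<^sup>2 / ?L\<^sup>2 * signed_area \<gamma>"
    and energy: "integral {0..2 * pi} (\<lambda>s. (\<kappa>' s)\<^sup>2)
       = (?L / (2 * pi)) ^ 3 * arc_integral \<gamma> (\<lambda>u. (arc_deriv \<gamma> (curvature \<gamma>) u)\<^sup>2)"
    and ex: "(\<exists>u. curvature \<gamma> u \<le> 0) \<longrightarrow> (\<exists>s\<in>{0..2 * pi}. \<kappa> s \<le> 0)"
    by (rule normalised_reparametrization)
  interpret unit_speed_curve z T \<kappa> \<kappa>' by (rule curve)
  have "8 * pi\<^sup>2 / ?L\<^sup>2 * signed_area \<gamma> \<le> 2 * pi"
    unfolding area[symmetric] by (rule unit_speed_isoperimetric[OF z continuous_on_T unit per(1)])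
  then have "?L\<^sup>2 / (8 * pi\<^sup>2) * (8 * pi\<^sup>2 / ?L\<^sup>2 * signed_area \<gamma>) \<le> ?L\<^sup>2 / (8 * pi\<^sup>2) * (2 * pi)"
    by (intro mult_left_mono) auto
  also have "?L\<^sup>2 / (8 * pi\<^sup>2) * (8 * pi\<^sup>2 / ?L\<^sup>2 * signed_area \<gamma>) = signed_area \<gamma>"
    using L by simp
  also have "?L\<^sup>2 / (8 * pi\<^sup>2) * (2 * pi) = ?L\<^sup>2 / (4 * pi)"
    by (simp add: power2_eq_square)
  finally show ?thesis .
qed

text \<open>The left-hand side of \<open>deficit\<close> is the deficit of the normalised curve,
  because its area integral is \<open>8 * pi\<^sup>2 / L\<^sup>2\<close> times the signed area.
  Undoing the scaling multiplies \<open>pi\<close> by \<open>(2 * pi / L) ^ 3\<close>.\<close>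

lemma curvature_energy_lower_bound:
  assumes "arc_integral \<gamma> (curvature \<gamma>) = 2 * pi"
    and deficit: "4 * pi * (1 - 4 * pi * signed_area \<gamma> / (curve_length \<gamma>)\<^sup>2) \<le> 1 / (18 * pi)"
    and "curvature \<gamma> u \<le> 0"
  shows "8 * pi ^ 4 / curve_length \<gamma> ^ 3 \<le> arc_integral \<gamma> (\<lambda>u. (arc_deriv \<gamma> (curvature \<gamma>) u)\<^sup>2)"
proof -
  let ?L = "curve_length \<gamma>"
  note L = curve_length_pos
  obtain z T \<kappa> \<kappa>' where curve: "unit_speed_curve z T \<kappa> \<kappa>'"
    and total: "integral {0..2 * pi} \<kappa> = arc_integral \<gamma> (curvature \<gamma>)"
    and area: "integral {0..2 * pi} (\<lambda>s. Im (cnj (z s) * T s)) = 8 * pi\<^sup>2 / ?L\<^sup>2 * signed_area \<gamma>"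
    and energy: "integral {0..2 * pi} (\<lambda>s. (\<kappa>' s)\<^sup>2)
       = (?L / (2 * pi)) ^ 3 * arc_integral \<gamma> (\<lambda>u. (arc_deriv \<gamma> (curvature \<gamma>) u)\<^sup>2)"
    and ex: "(\<exists>u. curvature \<gamma> u \<le> 0) \<longrightarrow> (\<exists>s\<in>{0..2 * pi}. \<kappa> s \<le> 0)"
    by (rule normalised_reparametrization)
  interpret unit_speed_curve z T \<kappa> \<kappa>' by (rule curve)
  obtain s where s: "s \<in> {0..2 * pi}" "\<kappa> s \<le> 0" using ex assms(3) by blast
  have "pi \<le> integral {0..2 * pi} (\<lambda>s. (\<kappa>' s)\<^sup>2)"
  proof (rule curvature_energy_ge_pi[OF _ _ s])
    show "integral {0..2 * pi} \<kappa> = 2 * pi" using total assms(1) by simp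
    show "2 * (2 * pi - integral {0..2 * pi} (\<lambda>s. Im (cnj (z s) * T s))) \<le> 1 / (18 * pi)"
      using deficit unfolding area by (simp add: algebra_simps power2_eq_square)
  qed
  then have "(2 * pi / ?L) ^ 3 * pi \<le> (2 * pi / ?L) ^ 3 * integral {0..2 * pi} (\<lambda>s. (\<kappa>' s)\<^sup>2)"
    using L by (intro mult_left_mono) auto
  also have "\<dots> = ((2 * pi / ?L) * (?L / (2 * pi))) ^ 3 * arc_integral \<gamma> (\<lambda>u. (arc_deriv \<gamma> (curvature \<gamma>) u)\<^sup>2)"
    unfolding energy power_mult_distrib by simp
  also have "(2 * pi / ?L) * (?L / (2 * pi)) = 1" using L by simp
  also have "(2 * pi / ?L) ^ 3 * pi = 8 * pi ^ 4 / ?L ^ 3"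
    by (simp add: power_divide power_mult_distrib eval_nat_numeral)
  finally show ?thesis by simp
qed

end

section \<open>First variation of total curvature, length and area\<close>

lemma has_vector_derivative_quotient:
  fixes f g :: "real \<Rightarrow> 'a::real_normed_field"
  assumes "(f has_vector_derivative f') (at x within S)" "(g has_vector_derivative g') (at x within S)" "g x \<noteq> 0"
  shows "((\<lambda>x. f x / g x) has_vector_derivative (f' * g x - f x * g') / (g x)\<^sup>2) (at x within S)"
  using has_derivative_divide'[OF assms(1,2)[unfolded has_vector_derivative_def] assms(3)]
  unfolding has_vector_derivative_def
  by (rule has_derivative_eq_rhs) (auto simp: power2_eq_square scaleR_conv_of_real algebra_simps)

text \<open>Provides uniqueness of time derivatives, including the one-sided ones at time 0.\<close>

lemma at_within_Ici_neq_bot: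
  fixes t :: real
  assumes "0 \<le> t"
  shows "at t within {0..} \<noteq> bot"
proof
  assume "at t within {0..} = bot"
  moreover have "at_right t \<le> at t within {0..}" using assms by (intro at_le) auto
  ultimately show False using trivial_limit_at_right_real[of t] by (simp add: bot_unique)
qed

context closed_curve_jet
begin

lemma has_integral_curvature_ss:
  "((\<lambda>u. arc_deriv \<gamma> (arc_deriv \<gamma> (curvature \<gamma>)) u * speed \<gamma> u) has_integral 0) {0..2 * pi}"
  using arc_deriv_curvature_period[of 0]
    arc_deriv_curvature_deriv[unfolded has_real_derivative_iff_has_vector_derivative, THEN has_vector_derivative_at_within]
  by (intro integral_deriv_closed[where F = "arc_deriv \<gamma> (curvature \<gamma>)"]) auto

text \<open>Integration by parts; periodicity removes the boundary term.\<close>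

lemma has_integral_curvature_times_curvature_ss:
  "((\<lambda>u. curvature \<gamma> u * (arc_deriv \<gamma> (arc_deriv \<gamma> (curvature \<gamma>)) u * speed \<gamma> u)) has_integral
     - arc_integral \<gamma> (\<lambda>u. (arc_deriv \<gamma> (curvature \<gamma>) u)\<^sup>2)) {0..2 * pi}"
proof -
  let ?ks = "arc_deriv \<gamma> (curvature \<gamma>)" and ?kss = "arc_deriv \<gamma> (arc_deriv \<gamma> (curvature \<gamma>))"
  have "((\<lambda>u. curvature \<gamma> u * (?kss u * speed \<gamma> u) + ?ks u * speed \<gamma> u * ?ks u) has_integral 0) {0..2 * pi}"
    using curvature_period[of 0] arc_deriv_curvature_period[of 0]
    by (intro integral_deriv_closed[where F = "\<lambda>u. curvature \<gamma> u * ?ks u"] has_vector_derivative_mult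
        curvature_deriv[unfolded has_real_derivative_iff_has_vector_derivative, THEN has_vector_derivative_at_within]
        arc_deriv_curvature_deriv[unfolded has_real_derivative_iff_has_vector_derivative, THEN has_vector_derivative_at_within])
      auto
  moreover have "((\<lambda>u. (?ks u)\<^sup>2 * speed \<gamma> u) has_integral arc_integral \<gamma> (\<lambda>u. (?ks u)\<^sup>2)) {0..2 * pi}"
    unfolding arc_integral_def
    by (intro integrable_integral integrable_continuous_real continuous_intros
        continuous_arc_deriv_curvature continuous_speed)
  ultimately have "((\<lambda>u. (curvature \<gamma> u * (?kss u * speed \<gamma> u) + ?ks u * speed \<gamma> u * ?ks u) - (?ks u)\<^sup>2 * speed \<gamma> u)
      has_integral (0 - arc_integral \<gamma> (\<lambda>u. (?ks u)\<^sup>2))) {0..2 * pi}"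
    by (rule has_integral_diff)
  then show ?thesis by (simp add: power2_eq_square algebra_simps)
qed

lemma velocity_eq: "speed \<gamma> u *\<^sub>R arc_deriv \<gamma> \<gamma> u = G 1 u"
  using p_pos[of u] by (simp add: tangent_eq speed_eq)

text \<open>This is the derivative of the argument of the velocity, as the imaginary part of a
  logarithmic derivative. In this form the integrand of the total curvature is easily differentiated
  in time.\<close>

lemma curvature_times_speed: "curvature \<gamma> u * speed \<gamma> u = Im (G 2 u / G 1 u)"
proof -
  have "curvature \<gamma> u * speed \<gamma> u = N u / (p u)\<^sup>2"
    using p_pos[of u] by (simp add: curvature_eq speed_eq power2_eq_square power3_eq_cube)
  then show ?thesis
    by (simp add: N_def p_def complex_div_cnj[of "G 2 u"] mult.commute)
qed

lemma signed_area_eq_velocity: "signed_area \<gamma> = 1 / 2 * integral {0..2 * pi} (\<lambda>u. Im (cnj (\<gamma> u) * G 1 u))"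
  unfolding signed_area_eq arc_integral_def velocity_eq[symmetric]
  by (simp add: algebra_simps)

lemma unit_normal_velocity: "speed \<gamma> u *\<^sub>R unit_normal \<gamma> u = \<i> * G 1 u"
  unfolding velocity_eq[symmetric] unit_normal_def by (simp add: scaleR_conv_of_real)

end

text \<open>\<open>D 1 0\<close> is the full velocity of the family, tangential part included, and
  \<open>D 0 n t\<close> are the parameter derivatives of the curve at time
  \<open>t\<close>.\<close>

locale smooth_closed_curve_family =
  fixes \<gamma> :: "real \<Rightarrow> real \<Rightarrow> complex" and D :: "nat \<Rightarrow> nat \<Rightarrow> real \<Rightarrow> real \<Rightarrow> complex"
  assumes D_0: "D 0 0 = \<gamma>"
    and D_cont: "\<And>m n. continuous_on ({0..} \<times> UNIV) (\<lambda>(t, u). D m n t u)"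
    and D_time: "\<And>m n t u. 0 \<le> t \<Longrightarrow> ((\<lambda>\<tau>. D m n \<tau> u) has_vector_derivative D (Suc m) n t u) (at t within {0..})"
    and D_space: "\<And>m n t u. 0 \<le> t \<Longrightarrow> (D m n t has_vector_derivative D m (Suc n) t u) (at u)"
    and jet: "\<And>t. 0 \<le> t \<Longrightarrow> closed_curve_jet (\<gamma> t) (\<lambda>n. D 0 n t)"
begin

lemma D_time_0: "0 \<le> t \<Longrightarrow> ((\<lambda>\<tau>. D 0 n \<tau> u) has_vector_derivative D 1 n t u) (at t within {0..})"
  using D_time[of t 0 n u] by simp

lemma D_space_0: "0 \<le> t \<Longrightarrow> (D m 0 t has_vector_derivative D m 1 t u) (at u)"
  using D_space[of t m 0 u] by simp

lemma D_space_1: "0 \<le> t \<Longrightarrow> (D m 1 t has_vector_derivative D m 2 t u) (at u)"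
  using D_space[of t m 1 u] by (simp add: numeral_2_eq_2)

lemma D_cont_pair: "continuous_on ({0..} \<times> S) (\<lambda>x. D m n (fst x) (snd x))"
  using continuous_on_subset[OF D_cont[of m n], of "{0..} \<times> S"] by (auto simp: case_prod_beta')

lemma D_cont_space: "0 \<le> t \<Longrightarrow> continuous_on S (D m n t)"
  by (rule continuous_on_vector_derivative[OF D_space[THEN has_vector_derivative_at_within]])

lemma D01_nonzero: "0 \<le> t \<Longrightarrow> D 0 1 t u \<noteq> 0"
  using closed_curve_jet.jet_1_nonzero[OF jet] .

lemma D1_period:
  assumes "0 \<le> t"
  shows "D 1 n t (u + 2 * pi) = D 1 n t u"
proof (rule vector_derivative_unique_within[OF at_within_Ici_neq_bot[OF assms]])
  show "((\<lambda>\<tau>. D 0 n \<tau> u) has_vector_derivative D 1 n t u) (at t within {0..})"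
    using D_time_0[OF assms] .
  show "((\<lambda>\<tau>. D 0 n \<tau> u) has_vector_derivative D 1 n t (u + 2 * pi)) (at t within {0..})"
    by (rule has_vector_derivative_transform[OF _ _ D_time_0[OF assms]])
      (use assms closed_curve_jet.jet_period[OF jet] in auto)
qed

text \<open>Valid for every smooth family of regular closed curves: mixed partials commute, so the
  time derivative of \<open>Im (D 0 2 / D 0 1)\<close> is the spatial derivative of the periodic
  function \<open>Im (D 1 1 / D 0 1)\<close>.\<close>

lemma total_curvature_constant:
  assumes "0 \<le> t"
  shows "arc_integral (\<gamma> t) (curvature (\<gamma> t)) = arc_integral (\<gamma> 0) (curvature (\<gamma> 0))"
proof -
  let ?f = "\<lambda>t u. Im (D 0 2 t u / D 0 1 t u)"
  let ?f' = "\<lambda>t u. Im ((D 1 2 t u * D 0 1 t u - D 0 2 t u * D 1 1 t u) / (D 0 1 t u)\<^sup>2)"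
  let ?F = "\<lambda>t. integral (cbox 0 (2 * pi)) (?f t)"
  have eq: "arc_integral (\<gamma> t) (curvature (\<gamma> t)) = ?F t" if "0 \<le> t" for t
    unfolding arc_integral_def closed_curve_jet.curvature_times_speed[OF jet[OF that]] by simp
  have F': "(?F has_vector_derivative 0) (at t within {0..})" if t: "t \<in> {0..}" for t
  proof -
    have "(?F has_vector_derivative integral (cbox 0 (2 * pi)) (?f' t)) (at t within {0..})"
    proof (rule leibniz_rule_vector_derivative)
      show "((\<lambda>t. ?f t u) has_vector_derivative ?f' t u) (at t within {0..})" if "t \<in> {0..}" for t u
        using that
        by (intro bounded_linear.has_vector_derivative[OF bounded_linear_Im] has_vector_derivative_quotient
            D_time_0 D01_nonzero) auto
      show "?f t integrable_on cbox 0 (2 * pi)" if "t \<in> {0..}" for t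
        using that by (intro integrable_continuous continuous_intros D_cont_space) (auto simp: D01_nonzero[unfolded One_nat_def])
      show "continuous_on ({0..} \<times> cbox 0 (2 * pi)) (\<lambda>(t, u). ?f' t u)"
        unfolding case_prod_beta'
        by (intro continuous_intros D_cont_pair) (auto simp: D01_nonzero[unfolded One_nat_def])
    qed (use t in auto)
    moreover have "(?f' t has_integral 0) {0..2 * pi}"
    proof (rule integral_deriv_closed)
      have t0: "0 \<le> t" using t by simp
      show "((\<lambda>u. Im (D 1 1 t u / D 0 1 t u)) has_vector_derivative ?f' t u) (at u within {0..2 * pi})" for u
        by (rule has_vector_derivative_eq_rhs[OF bounded_linear.has_vector_derivative[OF bounded_linear_Im
            has_vector_derivative_quotient[OF D_space_1[OF t0, THEN has_vector_derivative_at_within]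
              D_space_1[OF t0, THEN has_vector_derivative_at_within] D01_nonzero[OF t0]]]])
          (simp add: mult.commute)
      show "Im (D 1 1 t 0 / D 0 1 t 0) = Im (D 1 1 t (2 * pi) / D 0 1 t (2 * pi))"
        using D1_period[OF t0, of 1 0] closed_curve_jet.jet_period[OF jet[OF t0], of 1 0] by simp
    qed simp
    ultimately show ?thesis by (simp add: integral_unique)
  qed
  obtain c where "\<And>t. t \<in> {0..} \<Longrightarrow> ?F t = c"
    using has_vector_derivative_zero_constant[OF convex_real_interval(1) F'] by blast
  then have "?F t = ?F 0" using assms by simp
  then show ?thesis using eq[OF assms] eq[of 0] by simp
qed

text \<open>The speed changes at the rate \<open>D 1 1 t u \<bullet> ?T u\<close>. Integration by
  parts moves the spatial derivative to the tangent, whose derivative is normal by Frenet's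
  equation, so the tangential velocity drops out.\<close>

lemma curve_length_deriv:
  assumes "0 \<le> t"
  shows "((\<lambda>t. curve_length (\<gamma> t)) has_real_derivative
    - arc_integral (\<gamma> t) (\<lambda>u. curvature (\<gamma> t) u * (D 1 0 t u \<bullet> unit_normal (\<gamma> t) u))) (at t within {0..})"
proof -
  interpret closed_curve_jet "\<gamma> t" "\<lambda>n. D 0 n t" using jet[OF assms] .
  let ?f = "\<lambda>t u. norm (D 0 1 t u)"
  let ?f' = "\<lambda>t u. (D 0 1 t u \<bullet> D 1 1 t u) / norm (D 0 1 t u)"
  let ?F = "\<lambda>t. integral (cbox 0 (2 * pi)) (?f t)"
  let ?T = "arc_deriv (\<gamma> t) (\<gamma> t)"
  let ?g = "\<lambda>u. curvature (\<gamma> t) u * (D 1 0 t u \<bullet> unit_normal (\<gamma> t) u) * speed (\<gamma> t) u"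
  have eq: "curve_length (\<gamma> t) = ?F t" if "0 \<le> t" for t
    unfolding curve_length_def arc_integral_def closed_curve_jet.speed_eq[OF jet[OF that]]
      closed_curve_jet.p_def[OF jet[OF that]] by simp
  have "(?F has_vector_derivative integral (cbox 0 (2 * pi)) (?f' t)) (at t within {0..})"
  proof (rule leibniz_rule_vector_derivative)
    show "((\<lambda>t. ?f t u) has_vector_derivative ?f' t u) (at t within {0..})" if "t \<in> {0..}" for t u
      unfolding has_real_derivative_iff_has_vector_derivative[symmetric]
      using that by (intro has_real_derivative_norm D_time_0 D01_nonzero) auto
    show "?f t integrable_on cbox 0 (2 * pi)" if "t \<in> {0..}" for t
      using that by (intro integrable_continuous continuous_intros D_cont_space) auto
    show "continuous_on ({0..} \<times> cbox 0 (2 * pi)) (\<lambda>(t, u). ?f' t u)"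
      unfolding case_prod_beta'
      by (intro continuous_intros D_cont_pair) (auto simp: D01_nonzero[unfolded One_nat_def])
  qed (use assms in auto)
  moreover have "(?f' t has_integral - integral {0..2 * pi} ?g) {0..2 * pi}"
  proof -
    have "((\<lambda>u. D 1 0 t u \<bullet> (of_real (curvature (\<gamma> t) u * speed (\<gamma> t) u) * (\<i> * ?T u)) + D 1 1 t u \<bullet> ?T u) has_integral 0)
        {0..2 * pi}"
    proof (rule integral_deriv_closed)
      show "((\<lambda>u. D 1 0 t u \<bullet> ?T u) has_vector_derivative
          D 1 0 t u \<bullet> (of_real (curvature (\<gamma> t) u * speed (\<gamma> t) u) * (\<i> * ?T u)) + D 1 1 t u \<bullet> ?T u)
          (at u within {0..2 * pi})" for u
        by (rule bounded_bilinear.has_vector_derivative[OF bounded_bilinear_inner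
              D_space_0[OF assms, THEN has_vector_derivative_at_within]
              tangent_deriv[THEN has_vector_derivative_at_within]])
      show "D 1 0 t 0 \<bullet> ?T 0 = D 1 0 t (2 * pi) \<bullet> ?T (2 * pi)"
        using D1_period[OF assms, of 0 0] tangent_period[of 0] by simp
    qed simp
    moreover have "D 1 0 t u \<bullet> (of_real (curvature (\<gamma> t) u * speed (\<gamma> t) u) * (\<i> * ?T u)) = ?g u" for u
      unfolding scaleR_conv_of_real[symmetric] unit_normal_def by simp
    moreover have "D 1 1 t u \<bullet> ?T u = ?f' t u" for u
      by (simp add: tangent_eq p_def inner_commute divide_inverse)
    ultimately have "((\<lambda>u. ?g u + ?f' t u) has_integral 0) {0..2 * pi}" by simp
    moreover have "(?g has_integral integral {0..2 * pi} ?g) {0..2 * pi}"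
      unfolding unit_normal_def
      by (intro integrable_integral integrable_continuous_real continuous_intros
          continuous_curvature continuous_speed continuous_tangent D_cont_space assms)
    ultimately have "((\<lambda>u. (?g u + ?f' t u) - ?g u) has_integral (0 - integral {0..2 * pi} ?g)) {0..2 * pi}"
      by (rule has_integral_diff)
    then show ?thesis by simp
  qed
  ultimately have "(?F has_real_derivative - integral {0..2 * pi} ?g) (at t within {0..})"
    by (simp add: has_real_derivative_iff_has_vector_derivative integral_unique)
  then show ?thesis
    unfolding arc_integral_def has_real_derivative_iff_has_vector_derivative
    by (rule has_vector_derivative_transform[rotated 2]) (use assms eq in auto)
qed

text \<open>The time derivative of the integrand and the spatial derivative of
  \<open>Im (cnj (D 0 0 t u) * D 1 0 t u)\<close> differ by twice the normal velocity times the
  speed, and the spatial derivative integrates to 0.\<close>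

lemma signed_area_deriv:
  assumes "0 \<le> t"
  shows "((\<lambda>t. signed_area (\<gamma> t)) has_real_derivative
    - arc_integral (\<gamma> t) (\<lambda>u. D 1 0 t u \<bullet> unit_normal (\<gamma> t) u)) (at t within {0..})"
proof -
  interpret closed_curve_jet "\<gamma> t" "\<lambda>n. D 0 n t" using jet[OF assms] .
  let ?f = "\<lambda>t u. Im (cnj (D 0 0 t u) * D 0 1 t u)"
  let ?f' = "\<lambda>t u. Im (cnj (D 0 0 t u) * D 1 1 t u + cnj (D 1 0 t u) * D 0 1 t u)"
  let ?F = "\<lambda>t. integral (cbox 0 (2 * pi)) (?f t)"
  let ?g = "\<lambda>u. (D 1 0 t u \<bullet> unit_normal (\<gamma> t) u) * speed (\<gamma> t) u"
  have eq: "signed_area (\<gamma> t) = 1 / 2 * ?F t" if "0 \<le> t" for t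
    unfolding closed_curve_jet.signed_area_eq_velocity[OF jet[OF that]] D_0 by simp
  have "(?F has_vector_derivative integral (cbox 0 (2 * pi)) (?f' t)) (at t within {0..})"
  proof (rule leibniz_rule_vector_derivative)
    show "((\<lambda>t. ?f t u) has_vector_derivative ?f' t u) (at t within {0..})" if "t \<in> {0..}" for t u
      using that
      by (intro bounded_linear.has_vector_derivative[OF bounded_linear_Im] has_vector_derivative_mult
          bounded_linear.has_vector_derivative[OF bounded_linear_cnj] D_time_0) auto
    show "?f t integrable_on cbox 0 (2 * pi)" if "t \<in> {0..}" for t
      using that by (intro integrable_continuous continuous_intros D_cont_space) auto
    show "continuous_on ({0..} \<times> cbox 0 (2 * pi)) (\<lambda>(t, u). ?f' t u)"
      unfolding case_prod_beta' by (intro continuous_intros D_cont_pair)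
  qed (use assms in auto)
  moreover have "(?f' t has_integral - 2 * integral {0..2 * pi} ?g) {0..2 * pi}"
  proof -
    have "((\<lambda>u. Im (cnj (D 0 0 t u) * D 1 1 t u + cnj (D 0 1 t u) * D 1 0 t u)) has_integral 0) {0..2 * pi}"
    proof (rule integral_deriv_closed)
      show "((\<lambda>u. Im (cnj (D 0 0 t u) * D 1 0 t u)) has_vector_derivative
          Im (cnj (D 0 0 t u) * D 1 1 t u + cnj (D 0 1 t u) * D 1 0 t u)) (at u within {0..2 * pi})" for u
        using assms
        by (intro bounded_linear.has_vector_derivative[OF bounded_linear_Im] has_vector_derivative_mult
          bounded_linear.has_vector_derivative[OF bounded_linear_cnj] D_space_0[THEN has_vector_derivative_at_within]) auto
      show "Im (cnj (D 0 0 t 0) * D 1 0 t 0) = Im (cnj (D 0 0 t (2 * pi)) * D 1 0 t (2 * pi))"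
        using D1_period[OF assms, of 0 0] jet_period[of 0 0] by simp
    qed simp
    moreover have "(?g has_integral integral {0..2 * pi} ?g) {0..2 * pi}"
      unfolding unit_normal_def
      by (intro integrable_integral integrable_continuous_real continuous_intros
          continuous_speed continuous_tangent D_cont_space assms)
    ultimately have *: "((\<lambda>u. Im (cnj (D 0 0 t u) * D 1 1 t u + cnj (D 0 1 t u) * D 1 0 t u) - 2 * ?g u) has_integral
       (0 - 2 * integral {0..2 * pi} ?g)) {0..2 * pi}"
      by (intro has_integral_diff has_integral_mult_right)
    have **: "Im (cnj (D 0 0 t u) * D 1 1 t u + cnj (D 0 1 t u) * D 1 0 t u) - 2 * ?g u = ?f' t u" for u
    proof -
      have "?g u = D 1 0 t u \<bullet> (\<i> * D 0 1 t u)"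
        unfolding unit_normal_velocity[symmetric] by simp
      then show ?thesis by (simp add: inner_complex_def algebra_simps)
    qed
    show ?thesis using *[unfolded **] by simp
  qed
  ultimately have "(?F has_real_derivative - 2 * integral {0..2 * pi} ?g) (at t within {0..})"
    by (simp add: has_real_derivative_iff_has_vector_derivative integral_unique)
  then have "((\<lambda>t. 1 / 2 * ?F t) has_real_derivative - integral {0..2 * pi} ?g) (at t within {0..})"
    by (auto intro!: derivative_eq_intros)
  then show ?thesis
    unfolding arc_integral_def has_real_derivative_iff_has_vector_derivative
    by (rule has_vector_derivative_transform[rotated 2]) (use assms eq in auto)
qed

end

section \<open>The set of times of non-convexity\<close>

text \<open>The defining function is strictly decreasing on the positive reals, so its zero there is
  unique and \<open>LEAST\<close> denotes it. It is nonpositive at 1/9, where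
  \<open>6 * x powr (1/2)\<close> already equals 2; thus twice \<open>K_star\<close> is at most
  1/9.\<close>

lemma K_star_le: "K_star \<le> 1 / 18"
proof -
  define a where "a = 1 / (4 * pi\<^sup>2 * sqrt (2 * pi))"
  define f where "f = (\<lambda>x::real. 2 - a * x powr (3/2) - 3 / (2 * pi) * x - 6 * x powr (1/2))"
  have a: "0 \<le> a" by (simp add: a_def)
  have anti: "f y < f x" if "0 < x" "x < y" for x y
  proof -
    have "a * x powr (3/2) \<le> a * y powr (3/2)"
      using that a by (intro mult_left_mono powr_mono2) auto
    moreover have "3 / (2 * pi) * x \<le> 3 / (2 * pi) * y"
      using that by (intro mult_left_mono) auto
    moreover have "x powr (1/2) < y powr (1/2)"
      using that by (intro powr_less_mono2) auto
    ultimately show ?thesis by (simp add: f_def)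
  qed
  have "f (1/9) \<le> 0"
  proof -
    have "(1/9::real) powr (1/2) = 1/3"
      by (simp add: powr_half_sqrt real_sqrt_divide)
    then have "f (1/9) = 2 - a * (1/9) powr (3/2) - 3 / (2 * pi) * (1/9) - 6 * (1/3)"
      by (simp only: f_def)
    moreover have "0 \<le> a * (1/9) powr (3/2)" using a by simp
    moreover have "0 \<le> 3 / (2 * pi) * (1/9)" by simp
    ultimately show ?thesis by linarith
  qed
  \<comment> \<open>\<open>f 0 = 2\<close> by the convention that 0 to any real power is 0; it also
    excludes \<open>x = 0\<close> below.\<close>
  moreover have "0 \<le> f 0" by (simp add: f_def)
  moreover have "continuous_on {0..1/9} f"
    unfolding f_def by (intro continuous_intros continuous_on_powr') auto
  ultimately obtain x where x: "0 \<le> x" "x \<le> 1/9" "f x = 0"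
    using IVT2'[of f "1/9" 0 0] by auto
  moreover have "x \<noteq> 0" using x by (auto simp: f_def)
  ultimately have "(LEAST x. 0 < x \<and> f x = 0) = x"
    using anti by (intro Least_equality) (auto, metis less_irrefl not_less)
  then show ?thesis using x by (simp add: K_star_def f_def a_def)
qed

text \<open>A Chebyshev estimate: \<open>A\<close> grows at rate at least \<open>c\<close> on
  \<open>B\<close> and never decreases elsewhere, but has only \<open>M - A 0\<close> to gain. It is
  proved on bounded time intervals and passed to the limit along the increasing union. Integrability
  of \<open>A'\<close> comes from the fundamental theorem for the gauge integral.\<close>

lemma measure_le_of_deriv_ge:
  fixes A A' :: "real \<Rightarrow> real"
  assumes A: "\<And>t. 0 \<le> t \<Longrightarrow> (A has_real_derivative A' t) (at t within {0..})"
    and nonneg: "\<And>t. 0 \<le> t \<Longrightarrow> 0 \<le> A' t" and bound: "\<And>t. 0 \<le> t \<Longrightarrow> A t \<le> M"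
    and "0 < c" and B: "B \<subseteq> {0..}" "\<And>t. t \<in> B \<Longrightarrow> c \<le> A' t"
    and compact: "\<And>T. compact (B \<inter> {0..T})"
  shows "B \<in> lmeasurable \<and> measure lebesgue B \<le> (M - A 0) / c"
proof -
  define S where "S n = B \<inter> {0..real n}" for n
  have S: "S n \<in> lmeasurable" for n
    unfolding S_def by (rule lmeasurable_compact[OF compact])
  have le: "measure lebesgue (S n) \<le> (M - A 0) / c" for n
  proof -
    have "((\<lambda>t. indicat_real (S n) t * c) has_integral measure lebesgue (S n) * c) UNIV"
      using S[of n] by (intro has_integral_mult_left) (simp add: lmeasurable_iff_has_integral)
    then have "((\<lambda>t. if t \<in> {0..real n} then indicat_real (S n) t * c else 0) has_integral measure lebesgue (S n) * c) UNIV"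
      by (rule has_integral_eq[rotated]) (auto simp: indicator_def S_def)
    then have "((\<lambda>t. indicat_real (S n) t * c) has_integral measure lebesgue (S n) * c) {0..real n}"
      by (rule iffD1[OF has_integral_restrict_UNIV])
    moreover have "(A' has_integral (A (real n) - A 0)) {0..real n}"
    proof (rule fundamental_theorem_of_calculus)
      show "(A has_vector_derivative A' t) (at t within {0..real n})" if "t \<in> {0..real n}" for t
        using that A[of t] unfolding has_real_derivative_iff_has_vector_derivative
        by (auto elim: has_vector_derivative_within_subset)
    qed simp
    moreover have "indicat_real (S n) t * c \<le> A' t" if "t \<in> {0..real n}" for t
      using that nonneg[of t] B(2)[of t] by (auto simp: indicator_def S_def)
    ultimately have "measure lebesgue (S n) * c \<le> A (real n) - A 0"
      by (rule has_integral_le)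
    also have "\<dots> \<le> M - A 0" using bound[of "real n"] by simp
    finally show ?thesis using \<open>0 < c\<close> by (simp add: pos_le_divide_eq)
  qed
  have mono: "S n \<subseteq> S (Suc n)" for n by (auto simp: S_def)
  have "B = (\<Union>n. S n)"
    using B(1) real_arch_simple by (fastforce simp: S_def)
  then show ?thesis
    using measurable_nested_Union[where S = S, OF S le mono] le
      LIMSEQ_le_const2[OF measure_nested_Union[where S = S, OF S le mono]]
    by auto
qed

lemma smooth_family_closed_curves:
  assumes "smooth_family \<gamma>" and reg: "\<And>t. 0 \<le> t \<Longrightarrow> regular_closed_curve (\<gamma> t)"
  obtains D where "smooth_closed_curve_family \<gamma> D"
proof -
  from assms(1) obtain D where D: "D 0 0 = \<gamma>"
    "\<And>m n. continuous_on ({0..} \<times> UNIV) (\<lambda>(t, u). D m n t u)"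
    "\<And>m n t u. 0 \<le> t \<Longrightarrow> ((\<lambda>\<tau>. D m n \<tau> u) has_vector_derivative D (Suc m) n t u) (at t within {0..})"
    "\<And>m n t u. 0 \<le> t \<Longrightarrow> (D m n t has_vector_derivative D m (Suc n) t u) (at u)"
    unfolding smooth_family_def by blast
  have "closed_curve_jet (\<gamma> t) (\<lambda>n. D 0 n t)" if t: "0 \<le> t" for t
  proof
    show "D 0 0 t = \<gamma> t" using D(1) by simp
    show "(D 0 n t has_vector_derivative D 0 (Suc n) t u) (at u)" for n u by (rule D(4)[OF t])
    show "\<gamma> t (u + 2 * pi) = \<gamma> t u" for u
      using reg[OF t] unfolding regular_closed_curve_def by blast
    have "vector_derivative (\<gamma> t) (at u) = D 0 1 t u" for u
      using D(4)[OF t, of 0 0 u] D(1) by (simp add: vector_derivative_at)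
    then show "D 0 1 t u \<noteq> 0" for u
      using reg[OF t] unfolding regular_closed_curve_def by metis
  qed
  from smooth_closed_curve_family.intro[OF D this] show ?thesis by (rule that)
qed

context smooth_closed_curve_family
begin

text \<open>The sign of the curvature is that of a jointly continuous numerator, and by periodicity
  one period suffices. The set is therefore the projection of a compact set of pairs.\<close>

lemma compact_curvature_nonpos: "compact ({t. 0 \<le> t \<and> (\<exists>u. curvature (\<gamma> t) u \<le> 0)} \<inter> {0..T})"
proof -
  let ?K = "\<lambda>x. Im (cnj (D 0 1 (fst x) (snd x)) * D 0 2 (fst x) (snd x))"
  define C where "C = {x \<in> {0..T} \<times> {0..2 * pi}. ?K x \<le> 0}"
  have sign: "curvature (\<gamma> t) u \<le> 0 \<longleftrightarrow> ?K (t, u) \<le> 0" if "0 \<le> t" for t u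
  proof -
    interpret closed_curve_jet "\<gamma> t" "\<lambda>n. D 0 n t" using jet[OF that] .
    show ?thesis using p_pos[of u] by (simp add: curvature_eq N_def divide_le_0_iff)
  qed
  have per: "\<exists>v\<in>{0..2 * pi}. curvature (\<gamma> t) v \<le> 0" if "0 \<le> t" "curvature (\<gamma> t) u \<le> 0" for t u
    using periodic_representative[of "curvature (\<gamma> t)" u] closed_curve_jet.curvature_period[OF jet[OF that(1)]] that(2)
    by metis
  have "closed C"
    unfolding C_def
    by (intro continuous_on_closed_Collect_le continuous_intros
        continuous_on_subset[OF D_cont_pair[of "{0..2 * pi}"]] closed_Times) auto
  then have "compact (({0..T} \<times> {0..2 * pi}) \<inter> C)"
    by (intro compact_Int_closed compact_Times) auto
  then have "compact (fst ` C)"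
    by (intro compact_continuous_image continuous_intros) (auto simp: C_def Int_absorb1 Collect_conj_eq)
  moreover have "fst ` C = {t. 0 \<le> t \<and> (\<exists>u. curvature (\<gamma> t) u \<le> 0)} \<inter> {0..T}"
  proof (intro set_eqI iffI)
    fix t assume "t \<in> fst ` C"
    then show "t \<in> {t. 0 \<le> t \<and> (\<exists>u. curvature (\<gamma> t) u \<le> 0)} \<inter> {0..T}"
      using sign by (fastforce simp: C_def)
  next
    fix t assume "t \<in> {t. 0 \<le> t \<and> (\<exists>u. curvature (\<gamma> t) u \<le> 0)} \<inter> {0..T}"
    then obtain u where "0 \<le> t" "t \<le> T" "curvature (\<gamma> t) u \<le> 0" by auto
    moreover from this obtain v where "v \<in> {0..2 * pi}" "curvature (\<gamma> t) v \<le> 0"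
      using per by blast
    ultimately have "(t, v) \<in> C" using sign by (auto simp: C_def)
    then show "t \<in> fst ` C" by force
  qed
  ultimately show ?thesis by simp
qed

text \<open>With winding number 1, \<open>flow_h\<close> is \<open>- E / (2 * pi)\<close>. Pairing
  the normal velocity with the curvature gives \<open>2 * pi * h + E = 0\<close>, while its plain
  integral is \<open>h\<close> times the length; the two variation formulas do the rest.\<close>

lemma flow_length_area_deriv:
  assumes flow: "length_constrained_cdf \<gamma>" and total: "arc_integral (\<gamma> 0) (curvature (\<gamma> 0)) = 2 * pi"
    and t: "0 \<le> t"
  defines "E \<equiv> arc_integral (\<gamma> t) (\<lambda>u. (arc_deriv (\<gamma> t) (curvature (\<gamma> t)) u)\<^sup>2)"
  shows "((\<lambda>t. curve_length (\<gamma> t)) has_real_derivative 0) (at t within {0..})"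
    and "((\<lambda>t. signed_area (\<gamma> t)) has_real_derivative curve_length (\<gamma> t) / (2 * pi) * E) (at t within {0..})"
proof -
  interpret closed_curve_jet "\<gamma> t" "\<lambda>n. D 0 n t" using jet[OF t] .
  let ?k = "curvature (\<gamma> t)" and ?kss = "arc_deriv (\<gamma> t) (arc_deriv (\<gamma> t) (curvature (\<gamma> t)))"
  let ?h = "flow_h (\<gamma> t)"
  have total_t: "arc_integral (\<gamma> t) ?k = 2 * pi"
    using total_curvature_constant[OF t] total by simp
  have h: "?h = - E / (2 * pi)"
    by (simp add: flow_h_def curve_winding_def total_t E_def)
  have V: "D 1 0 t u \<bullet> unit_normal (\<gamma> t) u = ?h - ?kss u" for u
  proof -
    have "vector_derivative (\<lambda>\<tau>. \<gamma> \<tau> u) (at t within {0..}) = D 1 0 t u"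
      using D_time_0[OF t, of 0 u] unfolding D_0
      by (intro vector_derivative_within at_within_Ici_neq_bot t)
    then show ?thesis using flow t unfolding length_constrained_cdf_def by metis
  qed
  have "(\<lambda>u. ?k u * speed (\<gamma> t) u) integrable_on {0..2 * pi}"
    by (intro integrable_continuous_real continuous_intros continuous_curvature continuous_speed)
  then have k: "((\<lambda>u. ?k u * speed (\<gamma> t) u) has_integral 2 * pi) {0..2 * pi}"
    using total_t by (simp add: arc_integral_def has_integral_integrable_integral)
  have L: "(speed (\<gamma> t) has_integral curve_length (\<gamma> t)) {0..2 * pi}"
    unfolding curve_length_def arc_integral_def
    using integrable_integral[OF integrable_continuous_real[OF continuous_speed]] by simp
  have "((\<lambda>u. ?h * (?k u * speed (\<gamma> t) u) - ?k u * (?kss u * speed (\<gamma> t) u)) has_integral (?h * (2 * pi) - (- E))) {0..2 * pi}"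
    unfolding E_def
    by (intro has_integral_diff has_integral_mult_right k has_integral_curvature_times_curvature_ss)
  then have "arc_integral (\<gamma> t) (\<lambda>u. ?k u * (?h - ?kss u)) = ?h * (2 * pi) - (- E)"
    unfolding arc_integral_def by (intro integral_unique) (simp add: algebra_simps)
  also have "\<dots> = 0" unfolding h by simp
  finally show "((\<lambda>t. curve_length (\<gamma> t)) has_real_derivative 0) (at t within {0..})"
    using curve_length_deriv[OF t] unfolding V by simp
  have "((\<lambda>u. ?h * speed (\<gamma> t) u - ?kss u * speed (\<gamma> t) u) has_integral (?h * curve_length (\<gamma> t) - 0)) {0..2 * pi}"
    by (intro has_integral_diff has_integral_mult_right L has_integral_curvature_ss)
  then have "arc_integral (\<gamma> t) (\<lambda>u. ?h - ?kss u) = ?h * curve_length (\<gamma> t) - 0"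
    unfolding arc_integral_def by (intro integral_unique) (simp add: algebra_simps)
  then show "((\<lambda>t. signed_area (\<gamma> t)) has_real_derivative curve_length (\<gamma> t) / (2 * pi) * E) (at t within {0..})"
    using signed_area_deriv[OF t] unfolding V by (simp add: h mult.commute)
qed

end

text \<open>Membership in \<open>lmeasurable\<close> gives content to the inequality, since
  \<open>measure\<close> is 0 by convention on non-measurable sets and on sets of infinite
  measure.\<close>

theorem proposition1p2:
  fixes \<gamma>0 :: "real \<Rightarrow> complex" and \<gamma> :: "real \<Rightarrow> real \<Rightarrow> complex" and L0 A0 :: real
  assumes "regular_closed_curve \<gamma>0"
    and "curve_length \<gamma>0 = L0"
    and "signed_area \<gamma>0 = A0"
    and "A0 > 0"
    and "arc_integral \<gamma>0 (curvature \<gamma>0) = 2 * pi"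
    and "K_osc \<gamma>0 < K_star"
    and "isoperimetric_ratio \<gamma>0 < 4 * pi\<^sup>2 / (4 * pi\<^sup>2 - K_star)"
    and "length_constrained_cdf \<gamma>"
    and "\<gamma> 0 = \<gamma>0"
  shows "{t. t \<ge> 0 \<and> (\<exists>u. curvature (\<gamma> t) u \<le> 0)} \<in> lmeasurable \<and>
    measure lebesgue {t. t \<ge> 0 \<and> (\<exists>u. curvature (\<gamma> t) u \<le> 0)}
      \<le> L0\<^sup>2 / (4 * pi ^ 3) * (L0\<^sup>2 / (4 * pi) - A0)"
proof -
  have reg: "regular_closed_curve (\<gamma> t)" if "0 \<le> t" for t
    using assms(8) that by (simp add: length_constrained_cdf_def)
  have "smooth_family \<gamma>" using assms(8) by (simp add: length_constrained_cdf_def)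
  then obtain D where "smooth_closed_curve_family \<gamma> D"
    by (rule smooth_family_closed_curves[OF _ reg])
  then interpret smooth_closed_curve_family \<gamma> D .
  define E where "E t = arc_integral (\<gamma> t) (\<lambda>u. (arc_deriv (\<gamma> t) (curvature (\<gamma> t)) u)\<^sup>2)" for t
  define A where "A t = signed_area (\<gamma> t)" for t
  have total: "arc_integral (\<gamma> 0) (curvature (\<gamma> 0)) = 2 * pi" using assms(5,9) by simp
  note deriv = flow_length_area_deriv[OF assms(8) total]
  have L: "curve_length (\<gamma> t) = L0" if "0 \<le> t" for t
  proof -
    obtain c where "\<And>t. t \<in> {0..} \<Longrightarrow> curve_length (\<gamma> t) = c"
      using has_field_derivative_zero_constant[OF convex_real_interval(1), of 0 "\<lambda>t. curve_length (\<gamma> t)"] deriv(1)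
      by auto
    from this[of t] this[of 0] show ?thesis using that assms(2,9) by simp
  qed
  have L0: "0 < L0" using closed_curve_jet.curve_length_pos[OF jet, of 0] L by simp
  have A_deriv: "(A has_real_derivative L0 / (2 * pi) * E t) (at t within {0..})" if "0 \<le> t" for t
    using deriv(2)[OF that] L[OF that] by (simp add: A_def[abs_def] E_def)
  have E_nonneg: "0 \<le> E t" if "0 \<le> t" for t
    unfolding E_def arc_integral_def
    by (intro integral_nonneg integrable_continuous_real continuous_intros
        closed_curve_jet.continuous_arc_deriv_curvature[OF jet] closed_curve_jet.continuous_speed[OF jet] that)
      (simp add: speed_def)
  have A0: "A 0 = A0" using assms(3,9) by (simp add: A_def)
  have A_ge: "A0 \<le> A t" if "0 \<le> t" for t
  proof -
    have "((\<lambda>t. L0 / (2 * pi) * E t) has_integral (A t - A 0)) {0..t}"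
    proof (rule fundamental_theorem_of_calculus[OF that])
      show "(A has_vector_derivative L0 / (2 * pi) * E s) (at s within {0..t})" if "s \<in> {0..t}" for s
        using that A_deriv[of s] unfolding has_real_derivative_iff_has_vector_derivative
        by (auto elim: has_vector_derivative_within_subset)
    qed
    then have "0 \<le> A t - A 0"
      by (rule has_integral_nonneg) (use E_nonneg L0 in \<open>simp add: zero_le_mult_iff\<close>)
    then show ?thesis by (simp add: A0)
  qed
  \<comment> \<open>The ratio hypothesis says \<open>4 * pi\<^sup>2 * (L0\<^sup>2 - 4 * pi * A0) <
    L0\<^sup>2 * K_star\<close>. It persists because the area does not decrease; inserting
    \<open>K_star \<le> 1 / 18\<close> and dividing by \<open>L0\<^sup>2 * pi\<close> gives the
    required form.\<close>
  have deficit: "4 * pi * (1 - 4 * pi * A t / L0\<^sup>2) \<le> 1 / (18 * pi)" if t: "0 \<le> t" for t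
  proof -
    have K: "0 < 4 * pi\<^sup>2 - K_star"
    proof -
      have "1 \<le> pi\<^sup>2" using pi_ge_two by (intro one_le_power) simp
      then show ?thesis using K_star_le by linarith
    qed
    have d: "0 < 4 * pi * A0" using assms(4) by simp
    have "L0\<^sup>2 / (4 * pi * A0) < 4 * pi\<^sup>2 / (4 * pi\<^sup>2 - K_star)"
      using assms(2,3,7) by (simp add: isoperimetric_ratio_def)
    then have "L0\<^sup>2 < 4 * pi\<^sup>2 * (4 * pi * A0) / (4 * pi\<^sup>2 - K_star)"
      unfolding pos_divide_less_eq[OF d] by simp
    then have "L0\<^sup>2 * (4 * pi\<^sup>2 - K_star) < 4 * pi\<^sup>2 * (4 * pi * A0)"
      unfolding pos_less_divide_eq[OF K] .
    also have "\<dots> \<le> 4 * pi\<^sup>2 * (4 * pi * A t)" using A_ge[OF t] by simp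
    finally have "L0\<^sup>2 * (4 * pi\<^sup>2) - 4 * pi\<^sup>2 * (4 * pi * A t) \<le> L0\<^sup>2 * K_star"
      by (simp add: algebra_simps)
    also have "\<dots> \<le> L0\<^sup>2 * (1 / 18)" by (intro mult_left_mono K_star_le) auto
    finally have "4 * pi\<^sup>2 * (L0\<^sup>2 - 4 * pi * A t) \<le> L0\<^sup>2 / 18" by (simp add: algebra_simps)
    then have "4 * pi\<^sup>2 * (L0\<^sup>2 - 4 * pi * A t) / (L0\<^sup>2 * pi) \<le> L0\<^sup>2 / 18 / (L0\<^sup>2 * pi)"
      by (intro divide_right_mono) auto
    also have "L0\<^sup>2 / 18 / (L0\<^sup>2 * pi) = 1 / (18 * pi)" using L0 by simp
    also have "4 * pi\<^sup>2 * (L0\<^sup>2 - 4 * pi * A t) / (L0\<^sup>2 * pi) = 4 * pi * (1 - 4 * pi * A t / L0\<^sup>2)"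
      using L0 by (simp add: field_simps power2_eq_square)
    finally show ?thesis .
  qed
  define B where "B = {t. 0 \<le> t \<and> (\<exists>u. curvature (\<gamma> t) u \<le> 0)}"
  \<comment> \<open>The growth rate \<open>4 * pi ^ 3 / L0\<^sup>2\<close> is
    \<open>L0 / (2 * pi)\<close> times the energy bound \<open>8 * pi ^ 4 / L0 ^ 3\<close>; the
    ceiling \<open>L0\<^sup>2 / (4 * pi)\<close> for the area is the isoperimetric
    inequality.\<close>
  have "B \<in> lmeasurable \<and> measure lebesgue B \<le> (L0\<^sup>2 / (4 * pi) - A 0) / (4 * pi ^ 3 / L0\<^sup>2)"
  proof (rule measure_le_of_deriv_ge[OF A_deriv])
    show "0 \<le> L0 / (2 * pi) * E t" if "0 \<le> t" for t using E_nonneg[OF that] L0 by simp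
    show "A t \<le> L0\<^sup>2 / (4 * pi)" if "0 \<le> t" for t
      using closed_curve_jet.isoperimetric_inequality[OF jet[OF that]] L[OF that] by (simp add: A_def)
    show "0 < 4 * pi ^ 3 / L0\<^sup>2" using L0 by simp
    show "B \<subseteq> {0..}" by (auto simp: B_def)
    show "compact (B \<inter> {0..T})" for T unfolding B_def by (rule compact_curvature_nonpos)
    show "4 * pi ^ 3 / L0\<^sup>2 \<le> L0 / (2 * pi) * E t" if "t \<in> B" for t
    proof -
      from that obtain u where t: "0 \<le> t" and u: "curvature (\<gamma> t) u \<le> 0" by (auto simp: B_def)
      have "8 * pi ^ 4 / L0 ^ 3 \<le> E t"
        using closed_curve_jet.curvature_energy_lower_bound[OF jet[OF t] _ _ u]
          total_curvature_constant[OF t] total deficit[OF t] L[OF t]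
        by (simp add: A_def E_def)
      then have "L0 / (2 * pi) * (8 * pi ^ 4 / L0 ^ 3) \<le> L0 / (2 * pi) * E t"
        using L0 by (intro mult_left_mono) auto
      moreover have "L0 / (2 * pi) * (8 * pi ^ 4 / L0 ^ 3) = 4 * pi ^ 3 / L0\<^sup>2"
        using L0 by (simp add: field_simps eval_nat_numeral)
      ultimately show ?thesis by simp
    qed
  qed
  then show ?thesis by (simp add: B_def A0 mult.commute)
qed

end
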